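(* Let $k$ be an algebraically closed field of characteristic zero, let $\ell\ge1$, and let $u_1,\dots,u_\ell\in k$ be primitive roots of unity of order $10$ such that $u_iu_j\neq 1$ for all $i,j$. Then the product $\mathcal{F}_{u_1}\boxtimes\cdots\boxtimes\mathcal{F}_{u_\ell}$ of Fibonacci modular categories is completely anisotropic; that is, every simple, separable, commutative, ribbon algebra in it is isomorphic to the unit object with its canonical algebra structure.
   Context: The Fibonacci modular category $\mathcal{F}_u$: let $u$ be a primitive $10$-th root of unity in $k$ and $a=u+u^{-1}$ (so $a^2=a+1$). $\mathcal{F}_u$ is the semisimple $k$-linear category with two simple objects $I$ (strict monoidal unit) and $X$, and $X\otimes X=I\oplus X$. Fix basis vectors $\mu\in\mathrm{Hom}(X\otimes X,X)$ and $\varepsilon\in\mathrm{Hom}(X\otimes X,I)$. The associativity constraint $\alpha_{X,X,X}:(X\otimes X)\otimes X\to X\otimes (X\otimes X)$ is determined by $\varepsilon(1\otimes\mu)\circ\alpha_{X,X,X}=\varepsilon(\mu\otimes 1)$, $\ \mu(1\otimes\mu)\circ\alpha_{X,X,X}=a\,\mu(\mu\otimes1)+(\varepsilon\otimes 1)$, $\ (1\otimes\varepsilon)\circ\alpha_{X,X,X}=-a\,\mu(\mu\otimes1)-a\,(\varepsilon\otimes1)$. The braiding is given by $\mu\circ c_{X,X}=u\,\mu$, $\varepsilon\circ c_{X,X}=u^2\,\varepsilon$, and the ribbon twist by $\theta_I=\mathrm{id}_I$, $\theta_X=u^{-2}\mathrm{id}_X$. The Deligne tensor product $\mathcal{C}\boxtimes\mathcal{D}$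 of fusion categories has simple objects $Y\boxtimes Z$ ($Y$, $Z$ simple) and componentwise tensor product, braiding and twist. Algebras: an algebra in a monoidal category is an object $A$ with associative multiplication $\mu_A:A\otimes A\to A$ and unit $\iota:I\to A$. It is simple if any non-zero algebra homomorphism out of it is injective. In a braided rigid category, it is commutative if $\mu_A c_{A,A}=\mu_A$. It is separable if the pairing $e=\epsilon_A\circ\mu_A:A\otimes A\to I$ is non-degenerate, where $\epsilon_A$ is the composite $A\to A\otimes A\otimes A^*\xrightarrow{\mu_A\otimes1}A\otimes A^*\xrightarrow{c_{A,A^*}}A^*\otimes A\xrightarrow{ev_A}I$ (the first arrow is $1\otimes\mathrm{coev}_A$). Non-degenerate means that there is $\kappa:I\to A\otimes A$ with $(e\otimes1)(1\otimes\kappa)=\mathrm{id}_A$. In a ribbon category, a commutative algebra $A$ is ribbon if $\theta_A=\mathrm{id}_A$. *)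

theory Defs
  imports
    "HOL-Library.FuncSet"
    "HOL-Computational_Algebra.Polynomial"
begin

section \<open>Ribbon categories and their algebras\<close>

text \<open>
  The structure maps of a ribbon category with zero morphisms.  Composition is written in the
  usual order: \<open>f \<cdot> g\<close> is \<open>f\<close> after \<open>g\<close>.  A morphism value need not determine its source and
  target, so the operations that depend on objects take them as arguments.
\<close>

record ('o, 'm) ribbon_category =
  Obj :: "'o set"
  Hom :: "'o \<Rightarrow> 'o \<Rightarrow> 'm set"
  Id :: "'o \<Rightarrow> 'm"  ("\<one>\<index>")
  Comp :: "'m \<Rightarrow> 'm \<Rightarrow> 'm"  (infixr "\<cdot>\<index>" 65)
  Zero :: "'o \<Rightarrow> 'o \<Rightarrow> 'm"
  Unit :: "'o"  ("\<I>\<index>")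
  Tensor :: "'o \<Rightarrow> 'o \<Rightarrow> 'o"  (infixr "\<otimes>\<index>" 70)
  TensorM :: "'m \<Rightarrow> 'm \<Rightarrow> 'm"  (infixr "\<odot>\<index>" 70)
  Assoc :: "'o \<Rightarrow> 'o \<Rightarrow> 'o \<Rightarrow> 'm"  \<comment> \<open>\<open>(A \<otimes> B) \<otimes> C \<rightarrow> A \<otimes> (B \<otimes> C)\<close>\<close>
  LUnit :: "'o \<Rightarrow> 'm"  \<comment> \<open>\<open>I \<otimes> A \<rightarrow> A\<close>\<close>
  RUnit :: "'o \<Rightarrow> 'm"  \<comment> \<open>\<open>A \<otimes> I \<rightarrow> A\<close>\<close>
  Braid :: "'o \<Rightarrow> 'o \<Rightarrow> 'm"  \<comment> \<open>\<open>A \<otimes> B \<rightarrow> B \<otimes> A\<close>\<close>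
  Twist :: "'o \<Rightarrow> 'm"

definition inverse_mor :: "('o, 'm) ribbon_category \<Rightarrow> 'o \<Rightarrow> 'o \<Rightarrow> 'm \<Rightarrow> 'm \<Rightarrow> bool" where
  "inverse_mor C A B f g \<longleftrightarrow> f \<in> Hom C A B \<and> g \<in> Hom C B A \<and>
     g \<cdot>\<^bsub>C\<^esub> f = \<one>\<^bsub>C\<^esub> A \<and> f \<cdot>\<^bsub>C\<^esub> g = \<one>\<^bsub>C\<^esub> B"

definition inv_mor :: "('o, 'm) ribbon_category \<Rightarrow> 'o \<Rightarrow> 'o \<Rightarrow> 'm \<Rightarrow> 'm" where
  "inv_mor C A B f = (THE g. inverse_mor C A B f g)"

abbreviation AssocInv :: "('o, 'm) ribbon_category \<Rightarrow> 'o \<Rightarrow> 'o \<Rightarrow> 'o \<Rightarrow> 'm" where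
  "AssocInv C A B D \<equiv>
     inv_mor C ((A \<otimes>\<^bsub>C\<^esub> B) \<otimes>\<^bsub>C\<^esub> D) (A \<otimes>\<^bsub>C\<^esub> (B \<otimes>\<^bsub>C\<^esub> D)) (Assoc C A B D)"

abbreviation LUnitInv :: "('o, 'm) ribbon_category \<Rightarrow> 'o \<Rightarrow> 'm" where
  "LUnitInv C A \<equiv> inv_mor C (\<I>\<^bsub>C\<^esub> \<otimes>\<^bsub>C\<^esub> A) A (LUnit C A)"

abbreviation RUnitInv :: "('o, 'm) ribbon_category \<Rightarrow> 'o \<Rightarrow> 'm" where
  "RUnitInv C A \<equiv> inv_mor C (A \<otimes>\<^bsub>C\<^esub> \<I>\<^bsub>C\<^esub>) A (RUnit C A)"

definition monic :: "('o, 'm) ribbon_category \<Rightarrow> 'o \<Rightarrow> 'o \<Rightarrow> 'm \<Rightarrow> bool" where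
  "monic C A B f \<longleftrightarrow> f \<in> Hom C A B \<and>
     (\<forall>Z\<in>Obj C. \<forall>g\<in>Hom C Z A. \<forall>h\<in>Hom C Z A. f \<cdot>\<^bsub>C\<^esub> g = f \<cdot>\<^bsub>C\<^esub> h \<longrightarrow> g = h)"

text \<open>\<open>D\<close> is a dual of \<open>A\<close>, with evaluation \<open>D \<otimes> A \<rightarrow> I\<close> and coevaluation \<open>I \<rightarrow> A \<otimes> D\<close>.\<close>

definition is_dual :: "('o, 'm) ribbon_category \<Rightarrow> 'o \<Rightarrow> 'o \<Rightarrow> 'm \<Rightarrow> 'm \<Rightarrow> bool" where
  "is_dual C A D ev coev \<longleftrightarrow> D \<in> Obj C \<and>
     ev \<in> Hom C (D \<otimes>\<^bsub>C\<^esub> A) \<I>\<^bsub>C\<^esub> \<and> coev \<in> Hom C \<I>\<^bsub>C\<^esub> (A \<otimes>\<^bsub>C\<^esub> D) \<and>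
     RUnit C A \<cdot>\<^bsub>C\<^esub> (\<one>\<^bsub>C\<^esub> A \<odot>\<^bsub>C\<^esub> ev) \<cdot>\<^bsub>C\<^esub> Assoc C A D A \<cdot>\<^bsub>C\<^esub> (coev \<odot>\<^bsub>C\<^esub> \<one>\<^bsub>C\<^esub> A) \<cdot>\<^bsub>C\<^esub> LUnitInv C A
       = \<one>\<^bsub>C\<^esub> A \<and>
     LUnit C D \<cdot>\<^bsub>C\<^esub> (ev \<odot>\<^bsub>C\<^esub> \<one>\<^bsub>C\<^esub> D) \<cdot>\<^bsub>C\<^esub> AssocInv C D A D \<cdot>\<^bsub>C\<^esub> (\<one>\<^bsub>C\<^esub> D \<odot>\<^bsub>C\<^esub> coev) \<cdot>\<^bsub>C\<^esub> RUnitInv C D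
       = \<one>\<^bsub>C\<^esub> D"

definition is_algebra :: "('o, 'm) ribbon_category \<Rightarrow> 'o \<Rightarrow> 'm \<Rightarrow> 'm \<Rightarrow> bool" where
  "is_algebra C A \<mu> \<iota> \<longleftrightarrow> A \<in> Obj C \<and>
     \<mu> \<in> Hom C (A \<otimes>\<^bsub>C\<^esub> A) A \<and> \<iota> \<in> Hom C \<I>\<^bsub>C\<^esub> A \<and>
     \<mu> \<cdot>\<^bsub>C\<^esub> (\<mu> \<odot>\<^bsub>C\<^esub> \<one>\<^bsub>C\<^esub> A) = \<mu> \<cdot>\<^bsub>C\<^esub> (\<one>\<^bsub>C\<^esub> A \<odot>\<^bsub>C\<^esub> \<mu>) \<cdot>\<^bsub>C\<^esub> Assoc C A A A \<and>
     \<mu> \<cdot>\<^bsub>C\<^esub> (\<iota> \<odot>\<^bsub>C\<^esub> \<one>\<^bsub>C\<^esub> A) = LUnit C A \<and>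
     \<mu> \<cdot>\<^bsub>C\<^esub> (\<one>\<^bsub>C\<^esub> A \<odot>\<^bsub>C\<^esub> \<iota>) = RUnit C A"

definition algebra_hom ::
  "('o, 'm) ribbon_category \<Rightarrow> 'o \<Rightarrow> 'm \<Rightarrow> 'm \<Rightarrow> 'o \<Rightarrow> 'm \<Rightarrow> 'm \<Rightarrow> 'm \<Rightarrow> bool" where
  "algebra_hom C A \<mu> \<iota> B \<nu> \<eta> f \<longleftrightarrow> f \<in> Hom C A B \<and>
     f \<cdot>\<^bsub>C\<^esub> \<mu> = \<nu> \<cdot>\<^bsub>C\<^esub> (f \<odot>\<^bsub>C\<^esub> f) \<and> f \<cdot>\<^bsub>C\<^esub> \<iota> = \<eta>"

definition isomorphic_algebras ::
  "('o, 'm) ribbon_category \<Rightarrow> 'o \<Rightarrow> 'm \<Rightarrow> 'm \<Rightarrow> 'o \<Rightarrow> 'm \<Rightarrow> 'm \<Rightarrow> bool" where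
  "isomorphic_algebras C A \<mu> \<iota> B \<nu> \<eta> \<longleftrightarrow>
     (\<exists>f g. algebra_hom C A \<mu> \<iota> B \<nu> \<eta> f \<and> inverse_mor C A B f g)"

text \<open>
  The zero algebra is not simple: the first conjunct says that the object \<open>A\<close> is non-zero.
  Without it the zero algebra would satisfy every condition below.
\<close>

definition simple_algebra :: "('o, 'm) ribbon_category \<Rightarrow> 'o \<Rightarrow> 'm \<Rightarrow> 'm \<Rightarrow> bool" where
  "simple_algebra C A \<mu> \<iota> \<longleftrightarrow> \<one>\<^bsub>C\<^esub> A \<noteq> Zero C A A \<and>
     (\<forall>B \<nu> \<eta> f. is_algebra C B \<nu> \<eta> \<and> algebra_hom C A \<mu> \<iota> B \<nu> \<eta> f \<and> f \<noteq> Zero C A B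
        \<longrightarrow> monic C A B f)"

definition commutative_algebra :: "('o, 'm) ribbon_category \<Rightarrow> 'o \<Rightarrow> 'm \<Rightarrow> bool" where
  "commutative_algebra C A \<mu> \<longleftrightarrow> \<mu> \<cdot>\<^bsub>C\<^esub> Braid C A A = \<mu>"

definition ribbon_algebra :: "('o, 'm) ribbon_category \<Rightarrow> 'o \<Rightarrow> bool" where
  "ribbon_algebra C A \<longleftrightarrow> Twist C A = \<one>\<^bsub>C\<^esub> A"

text \<open>
  The composite \<open>A \<rightarrow> A \<otimes> (A \<otimes> D) \<rightarrow> (A \<otimes> A) \<otimes> D \<rightarrow> A \<otimes> D \<rightarrow> D \<otimes> A \<rightarrow> I\<close>
  for a dual \<open>D\<close> of \<open>A\<close>.
\<close>

definition algebra_counit ::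
  "('o, 'm) ribbon_category \<Rightarrow> 'o \<Rightarrow> 'm \<Rightarrow> 'o \<Rightarrow> 'm \<Rightarrow> 'm \<Rightarrow> 'm" where
  "algebra_counit C A \<mu> D ev coev =
     ev \<cdot>\<^bsub>C\<^esub> Braid C A D \<cdot>\<^bsub>C\<^esub> (\<mu> \<odot>\<^bsub>C\<^esub> \<one>\<^bsub>C\<^esub> D) \<cdot>\<^bsub>C\<^esub> AssocInv C A A D
       \<cdot>\<^bsub>C\<^esub> (\<one>\<^bsub>C\<^esub> A \<odot>\<^bsub>C\<^esub> coev) \<cdot>\<^bsub>C\<^esub> RUnitInv C A"

definition nondegenerate_pairing :: "('o, 'm) ribbon_category \<Rightarrow> 'o \<Rightarrow> 'm \<Rightarrow> bool" where
  "nondegenerate_pairing C A e \<longleftrightarrow>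
     (\<exists>\<kappa>\<in>Hom C \<I>\<^bsub>C\<^esub> (A \<otimes>\<^bsub>C\<^esub> A).
        LUnit C A \<cdot>\<^bsub>C\<^esub> (e \<odot>\<^bsub>C\<^esub> \<one>\<^bsub>C\<^esub> A) \<cdot>\<^bsub>C\<^esub> AssocInv C A A A \<cdot>\<^bsub>C\<^esub> (\<one>\<^bsub>C\<^esub> A \<odot>\<^bsub>C\<^esub> \<kappa>) \<cdot>\<^bsub>C\<^esub> RUnitInv C A
          = \<one>\<^bsub>C\<^esub> A)"

text \<open>
  Duals are unique up to unique isomorphism and \<open>algebra_counit\<close> does not depend on the chosen
  one, so in a rigid category \<open>\<exists>\<close> and \<open>\<forall>\<close> agree here.
\<close>

definition separable_algebra :: "('o, 'm) ribbon_category \<Rightarrow> 'o \<Rightarrow> 'm \<Rightarrow> bool" where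
  "separable_algebra C A \<mu> \<longleftrightarrow>
     (\<exists>D ev coev. is_dual C A D ev coev \<and>
        nondegenerate_pairing C A (algebra_counit C A \<mu> D ev coev \<cdot>\<^bsub>C\<^esub> \<mu>))"

definition completely_anisotropic :: "('o, 'm) ribbon_category \<Rightarrow> bool" where
  "completely_anisotropic C \<longleftrightarrow>
     (\<forall>A \<mu> \<iota>. is_algebra C A \<mu> \<iota> \<and> simple_algebra C A \<mu> \<iota> \<and> separable_algebra C A \<mu> \<and>
        commutative_algebra C A \<mu> \<and> ribbon_algebra C A
        \<longrightarrow> isomorphic_algebras C A \<mu> \<iota> \<I>\<^bsub>C\<^esub> (LUnit C \<I>\<^bsub>C\<^esub>) (\<one>\<^bsub>C\<^esub> \<I>\<^bsub>C\<^esub>))"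


section \<open>Semisimple ribbon categories from skeletal data\<close>

text \<open>
  Data of a multiplicity-free semisimple ribbon category on representatives of its simple
  objects.  \<open>fuses a b c\<close> says that \<open>c\<close> occurs in \<open>a \<otimes> b\<close>, and a projection \<open>p\<^bsub>a,b,c\<^esub>\<close> from
  \<open>a \<otimes> b\<close> to \<open>c\<close> is fixed for each such triple (the unit constraint if \<open>a\<close> or \<open>b\<close> is the unit).
  The numbers are the coefficients in

    \<open>p\<^bsub>a,f,d\<^esub> (1 \<otimes> p\<^bsub>b,c,f\<^esub>) \<alpha>\<^bsub>a,b,c\<^esub> = (\<Sum>e. assoc_coeff a b c d f e * p\<^bsub>e,c,d\<^esub> (p\<^bsub>a,b,e\<^esub> \<otimes> 1))\<close>

    \<open>p\<^bsub>b,a,c\<^esub> c\<^bsub>a,b\<^esub> = braid_coeff a b c * p\<^bsub>a,b,c\<^esub>\<close>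

    \<open>\<theta>\<^bsub>a\<^esub> = twist_coeff a * id\<close>
\<close>

record ('l, 'k) fusion_data =
  simples :: "'l set"
  unit_simple :: "'l"
  fuses :: "'l \<Rightarrow> 'l \<Rightarrow> 'l \<Rightarrow> bool"
  assoc_coeff :: "'l \<Rightarrow> 'l \<Rightarrow> 'l \<Rightarrow> 'l \<Rightarrow> 'l \<Rightarrow> 'l \<Rightarrow> 'k"
  braid_coeff :: "'l \<Rightarrow> 'l \<Rightarrow> 'l \<Rightarrow> 'k"
  twist_coeff :: "'l \<Rightarrow> 'k"

text \<open>
  An object is a finite set of summands, each a copy of the simple object given by its label;
  the rest of a summand is only a name for it.  The summands \<open>Summand a n\<close> provide arbitrarily
  many copies of each simple object, and \<open>Fuse x y c\<close> names the summand \<open>c\<close> in the tensor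
  product of the summands \<open>x\<close> and \<open>y\<close>.
\<close>

datatype 'l summand = Summand 'l nat | Fuse "'l summand" "'l summand" 'l

fun label :: "'l summand \<Rightarrow> 'l" where
  "label (Summand a n) = a"
| "label (Fuse x y c) = c"

text \<open>
  A morphism is a matrix, rows indexed by the target and columns by the source, whose entries
  between summands with different labels vanish (Schur's lemma).
\<close>

type_synonym ('l, 'k) matrix = "'l summand \<Rightarrow> 'l summand \<Rightarrow> 'k"

definition mat_hom :: "'l summand set \<Rightarrow> 'l summand set \<Rightarrow> ('l, 'k::zero) matrix set" where
  "mat_hom A B = {f. \<forall>y x. f y x \<noteq> 0 \<longrightarrow> y \<in> B \<and> x \<in> A \<and> label y = label x}"

definition mat_diag :: "('l summand \<Rightarrow> 'k::zero) \<Rightarrow> 'l summand set \<Rightarrow> ('l, 'k) matrix" where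
  "mat_diag d A = (\<lambda>y x. if y = x \<and> x \<in> A then d x else 0)"

definition mat_comp ::
  "('l, 'k::semiring_1) matrix \<Rightarrow> ('l, 'k) matrix \<Rightarrow> ('l, 'k) matrix" where
  "mat_comp f g = (\<lambda>z x. \<Sum>y | g y x \<noteq> 0. f z y * g y x)"

definition sum_tensor ::
  "('l, 'k) fusion_data \<Rightarrow> 'l summand set \<Rightarrow> 'l summand set \<Rightarrow> 'l summand set" where
  "sum_tensor S A B =
     {Fuse x y c | x y c. x \<in> A \<and> y \<in> B \<and> c \<in> simples S \<and> fuses S (label x) (label y) c}"

definition mat_tensor ::
  "('l, 'k) fusion_data \<Rightarrow> ('l, 'k::semiring_1) matrix \<Rightarrow> ('l, 'k) matrix \<Rightarrow> ('l, 'k) matrix" where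
  "mat_tensor S f g = (\<lambda>t s. case (t, s) of
       (Fuse x' y' c', Fuse x y c) \<Rightarrow>
         if c' = c \<and> c \<in> simples S \<and> fuses S (label x) (label y) c then f x' x * g y' y else 0
     | _ \<Rightarrow> 0)"

definition mat_assoc ::
  "('l, 'k) fusion_data \<Rightarrow> 'l summand set \<Rightarrow> 'l summand set \<Rightarrow> 'l summand set
    \<Rightarrow> ('l, 'k::zero) matrix" where
  "mat_assoc S A B C = (\<lambda>t s.
     if t \<in> sum_tensor S A (sum_tensor S B C) \<and> s \<in> sum_tensor S (sum_tensor S A B) C then
       (case (t, s) of
          (Fuse x' (Fuse y' z' f) d', Fuse (Fuse x y e) z d) \<Rightarrow>
            if x' = x \<and> y' = y \<and> z' = z \<and> d' = d
            then assoc_coeff S (label x) (label y) (label z) d f e else 0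
        | _ \<Rightarrow> 0)
     else 0)"

definition mat_lunit ::
  "('l, 'k) fusion_data \<Rightarrow> 'l summand set \<Rightarrow> ('l, 'k::zero_neq_one) matrix" where
  "mat_lunit S A = (\<lambda>x s.
     if x \<in> A \<and> s = Fuse (Summand (unit_simple S) 0) x (label x) then 1 else 0)"

definition mat_runit ::
  "('l, 'k) fusion_data \<Rightarrow> 'l summand set \<Rightarrow> ('l, 'k::zero_neq_one) matrix" where
  "mat_runit S A = (\<lambda>x s.
     if x \<in> A \<and> s = Fuse x (Summand (unit_simple S) 0) (label x) then 1 else 0)"

definition mat_braid ::
  "('l, 'k) fusion_data \<Rightarrow> 'l summand set \<Rightarrow> 'l summand set \<Rightarrow> ('l, 'k::zero) matrix" where
  "mat_braid S A B = (\<lambda>t s.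
     if t \<in> sum_tensor S B A \<and> s \<in> sum_tensor S A B then
       (case (t, s) of
          (Fuse y' x' c', Fuse x y c) \<Rightarrow>
            if x' = x \<and> y' = y \<and> c' = c then braid_coeff S (label x) (label y) c else 0
        | _ \<Rightarrow> 0)
     else 0)"

definition semisimple_category ::
  "('l, 'k::field) fusion_data \<Rightarrow> ('l summand set, ('l, 'k) matrix) ribbon_category" where
  "semisimple_category S =
     \<lparr> Obj = {A. finite A \<and> label ` A \<subseteq> simples S},
       Hom = mat_hom,
       Id = mat_diag (\<lambda>x. 1),
       Comp = mat_comp,
       Zero = (\<lambda>A B y x. 0),
       Unit = {Summand (unit_simple S) 0},
       Tensor = sum_tensor S,
       TensorM = mat_tensor S,
       Assoc = mat_assoc S,
       LUnit = mat_lunit S,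
       RUnit = mat_runit S,
       Braid = mat_braid S,
       Twist = mat_diag (\<lambda>x. twist_coeff S (label x)) \<rparr>"

text \<open>
  The Deligne product of a finite family: its simple objects are the families of simple
  objects of the factors, and all structure is componentwise.
\<close>

definition deligne_product ::
  "'i set \<Rightarrow> ('i \<Rightarrow> ('l, 'k::field) fusion_data) \<Rightarrow> ('i \<Rightarrow> 'l, 'k) fusion_data" where
  "deligne_product J S =
     \<lparr> simples = (\<Pi>\<^sub>E i\<in>J. simples (S i)),
       unit_simple = (\<lambda>i\<in>J. unit_simple (S i)),
       fuses = (\<lambda>a b c. \<forall>i\<in>J. fuses (S i) (a i) (b i) (c i)),
       assoc_coeff = (\<lambda>a b c d f e. \<Prod>i\<in>J. assoc_coeff (S i) (a i) (b i) (c i) (d i) (f i) (e i)),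
       braid_coeff = (\<lambda>a b c. \<Prod>i\<in>J. braid_coeff (S i) (a i) (b i) (c i)),
       twist_coeff = (\<lambda>a. \<Prod>i\<in>J. twist_coeff (S i) (a i)) \<rparr>"


section \<open>The Fibonacci categories\<close>

datatype fib = I | X

fun fib_fuses :: "fib \<Rightarrow> fib \<Rightarrow> fib \<Rightarrow> bool" where
  "fib_fuses I b c \<longleftrightarrow> c = b"
| "fib_fuses X I c \<longleftrightarrow> c = X"
| "fib_fuses X X c \<longleftrightarrow> True"

text \<open>
  With \<open>\<mu> = p\<^bsub>X,X,X\<^esub>\<close> and \<open>\<epsilon> = p\<^bsub>X,X,I\<^esub>\<close>, and \<open>a = u + u\<^sup>-\<^sup>1\<close>, the constraint is given by
  \<open>\<epsilon>(1\<otimes>\<mu>)\<alpha> = \<epsilon>(\<mu>\<otimes>1)\<close>, \<open>\<mu>(1\<otimes>\<mu>)\<alpha> = a \<mu>(\<mu>\<otimes>1) + (\<epsilon>\<otimes>1)\<close> and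
  \<open>(1\<otimes>\<epsilon>)\<alpha> = - a \<mu>(\<mu>\<otimes>1) - a (\<epsilon>\<otimes>1)\<close>.
  The last catch-all equation covers \<open>\<epsilon>(1\<otimes>\<mu>)\<alpha>\<close> and the triples containing \<open>I\<close>, where \<open>\<alpha>\<close> is the
  identity because \<open>I\<close> is a strict unit.
\<close>

fun fib_assoc :: "'k::field \<Rightarrow> fib \<Rightarrow> fib \<Rightarrow> fib \<Rightarrow> fib \<Rightarrow> fib \<Rightarrow> fib \<Rightarrow> 'k" where
  "fib_assoc u X X X X X X = u + inverse u"
| "fib_assoc u X X X X X I = 1"
| "fib_assoc u X X X X I e = - (u + inverse u)"
| "fib_assoc u _ _ _ _ _ _ = 1"

fun fib_braid :: "'k::field \<Rightarrow> fib \<Rightarrow> fib \<Rightarrow> fib \<Rightarrow> 'k" where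
  "fib_braid u X X X = u"
| "fib_braid u X X I = u ^ 2"
| "fib_braid u _ _ _ = 1"

fun fib_twist :: "'k::field \<Rightarrow> fib \<Rightarrow> 'k" where
  "fib_twist u I = 1"
| "fib_twist u X = inverse (u ^ 2)"

definition fibonacci :: "'k::field \<Rightarrow> (fib, 'k) fusion_data" where
  "fibonacci u =
     \<lparr> simples = UNIV,
       unit_simple = I,
       fuses = fib_fuses,
       assoc_coeff = fib_assoc u,
       braid_coeff = fib_braid u,
       twist_coeff = fib_twist u \<rparr>"

definition primitive_root_of_unity :: "nat \<Rightarrow> 'k::field \<Rightarrow> bool" where
  "primitive_root_of_unity n u \<longleftrightarrow> u ^ n = 1 \<and> (\<forall>m. 0 < m \<and> m < n \<longrightarrow> u ^ m \<noteq> 1)"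

end

theory Submission
  imports "Jordan_Normal_Form.Char_Poly" Defs
begin

text \<open>Let \<open>A = \<Oplus>\<^sub>s V\<^sub>s \<otimes> X\<^sub>s\<close> be such an algebra.  For \<open>0 \<noteq> w \<in> V\<^sub>I\<close> the annihilator of \<open>w\<close> is a
  proper ideal, so it vanishes by simplicity, and therefore \<open>V\<^sub>I = k\<close>.  Triviality of the twist together
  with \<open>u\<^sub>i u\<^sub>j \<noteq> 1\<close> forces every other \<open>s\<close> with \<open>V\<^sub>s \<noteq> 0\<close> to have at least three coordinates equal to
  \<open>X\<close>.  For such an \<open>s\<close> with a minimal number of them, the associativity of \<open>A\<close>, read off at suitable
  intermediate simple objects, makes the product \<open>V\<^sub>s \<otimes> V\<^sub>s \<rightarrow> V\<^sub>I\<close> vanish.  This contradicts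
  separability, so \<open>A = V\<^sub>I = k\<close>.\<close>

section \<open>Matrix calculus\<close>

text \<open>Fusion here is multiplicity-free, so an algebra is an array of structure constants, and
  its associativity splits into one scalar equation for each intermediate label of the left
  bracketing. This is what later allows an equation to be read at a label that does not occur in
  \<open>A\<close>. Two obstacles shape the rest. Simplicity speaks of homomorphisms into algebras
  on finite sets of summands, so the quotient by an annihilator has to be realised on an actual
  subset of \<open>A\<close> and shown to be an algebra there. Separability involves inverse
  constraints that are given by a description; they become computable because every associativity
  block of a Fibonacci category is an involution, which is the equation a^2 = a + 1. The passage
  from injective multiplications to V_I = k is an eigenvalue argument: multiplication by c on the
  finite-dimensional space V_I has an eigenvalue k, so c - k1 kills an eigenvector, whence c =
  k1.\<close>

lemma mat_comp_reindex:
  assumes "finite K" "inj_on h K" "\<And>y. g y x \<noteq> 0 \<Longrightarrow> y \<in> h ` K"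
  shows "mat_comp f g z x = (\<Sum>a\<in>K. f z (h a) * g (h a) x)"
proof -
  \<comment> \<open>The definition sums over the support of a column, where an infinite support
    would yield the default 0. A finite set covering the support excludes this.\<close>
  have "mat_comp f g z x = (\<Sum>y\<in>h ` K. f z y * g y x)"
    unfolding mat_comp_def using assms by (intro sum.mono_neutral_left) auto
  then show ?thesis using assms(2) by (simp add: sum.reindex)
qed

lemma mat_comp_sum:
  assumes "finite K" "\<And>y. g y x \<noteq> 0 \<Longrightarrow> y \<in> K"
  shows "mat_comp f g z x = (\<Sum>y\<in>K. f z y * g y x)"
  using mat_comp_reindex[of K id g x f z] assms by simp

lemma mat_comp_single:
  assumes "\<And>y. g y x \<noteq> 0 \<Longrightarrow> y = a"
  shows "mat_comp f g z x = f z a * g a x"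
  using mat_comp_sum[of "{a}" g x f z] assms by auto

lemma mat_comp_zero_products:
  assumes "\<And>y. f z y * g y x = 0"
  shows "mat_comp f g z x = 0"
  unfolding mat_comp_def using assms by (intro sum.neutral) blast

lemma mat_comp_zero:
  assumes "\<And>y. g y x = 0"
  shows "mat_comp f g z x = 0"
  using mat_comp_sum[of "{}" g x f z] assms by auto

text \<open>Lets composites be analysed by following paths of non-zero entries, without evaluating
  sums.\<close>

lemma mat_comp_nonzeroE:
  assumes "mat_comp f g z x \<noteq> 0"
  obtains y where "f z y \<noteq> 0" "g y x \<noteq> 0"
  using assms unfolding mat_comp_def by (metis (no_types, lifting) mult_zero_left mult_zero_right sum.neutral)

lemma mat_homI:
  "(\<And>y x. f y x \<noteq> 0 \<Longrightarrow> y \<in> B \<and> x \<in> A \<and> label y = label x) \<Longrightarrow> f \<in> mat_hom A B"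
  by (auto simp: mat_hom_def)

lemma mat_homD:
  assumes "f \<in> mat_hom A B" "f y x \<noteq> 0"
  shows "y \<in> B" "x \<in> A" "label y = label x"
  using assms by (auto simp: mat_hom_def)

section \<open>Category laws for matrices and uniqueness of inverses\<close>

lemma mat_comp_assoc:
  fixes f g h :: "('l, 'k::field) matrix"
  assumes "finite A" "finite B" "g \<in> mat_hom A B" "h \<in> mat_hom D A"
  shows "mat_comp (mat_comp f g) h = mat_comp f (mat_comp g h)"
proof (intro ext)
  fix z x
  have 1: "h y x \<noteq> 0 \<Longrightarrow> y \<in> A" for y using assms by (auto dest: mat_homD)
  have 2: "g y a \<noteq> 0 \<Longrightarrow> y \<in> B" for y a using assms by (auto dest: mat_homD)
  have 3: "mat_comp g h y x \<noteq> 0 \<Longrightarrow> y \<in> B" for y by (auto elim!: mat_comp_nonzeroE intro: 2)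
  have "mat_comp (mat_comp f g) h z x = (\<Sum>a\<in>A. (\<Sum>b\<in>B. f z b * g b a) * h a x)"
    using mat_comp_sum[of A h x "mat_comp f g" z] mat_comp_sum[of B g _ f z] 1 2 assms by simp
  also have "\<dots> = (\<Sum>b\<in>B. f z b * (\<Sum>a\<in>A. g b a * h a x))"
    unfolding sum_distrib_left sum_distrib_right by (subst sum.swap) (simp add: mult.assoc)
  also have "\<dots> = mat_comp f (mat_comp g h) z x"
    using mat_comp_sum[of A h x g] mat_comp_sum[of B "mat_comp g h" x f z] 1 3 assms by simp
  finally show "mat_comp (mat_comp f g) h z x = mat_comp f (mat_comp g h) z x" .
qed

lemma mat_comp_diag_right:
  fixes f :: "('l, 'k::field) matrix"
  assumes "f \<in> mat_hom A B"
  shows "mat_comp f (mat_diag (\<lambda>x. 1) A) = f"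
proof (intro ext)
  fix z x
  have "mat_comp f (mat_diag (\<lambda>x. 1) A) z x = f z x * mat_diag (\<lambda>x. 1) A x x"
    by (rule mat_comp_single) (auto simp: mat_diag_def split: if_splits)
  also have "\<dots> = f z x" using mat_homD[OF assms, of z x] by (cases "f z x = 0") (auto simp: mat_diag_def)
  finally show "mat_comp f (mat_diag (\<lambda>x. 1) A) z x = f z x" .
qed

lemma mat_comp_diag_left:
  fixes f :: "('l, 'k::field) matrix"
  assumes "f \<in> mat_hom A B" "finite B"
  shows "mat_comp (mat_diag (\<lambda>x. 1) B) f = f"
proof (intro ext)
  fix z x
  have "mat_comp (mat_diag (\<lambda>x. 1) B) f z x = (\<Sum>y\<in>B. mat_diag (\<lambda>x. 1) B z y * f y x)"
    using assms by (intro mat_comp_sum) (auto dest: mat_homD)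
  also have "\<dots> = (\<Sum>y\<in>B. if z = y then f y x else 0)"
    by (intro sum.cong) (auto simp: mat_diag_def)
  also have "\<dots> = f z x" using mat_homD[OF assms(1), of z x] assms(2)
    by (cases "f z x = 0") (auto)
  finally show "mat_comp (mat_diag (\<lambda>x. 1) B) f z x = f z x" .
qed

text \<open>Any exhibited inverse is the described one, by the usual chain g' = (g f) g' = g (f g')
  = g. Finiteness of both objects is what makes matrix composition associative here.\<close>

lemma inv_mor_semisimple:
  fixes S :: "('l, 'k::field) fusion_data"
  assumes "finite A" "finite B" and inv: "inverse_mor (semisimple_category S) A B f g"
  shows "inv_mor (semisimple_category S) A B f = g"
  unfolding inv_mor_def
proof (rule the_equality[where P = "inverse_mor (semisimple_category S) A B f", OF inv])
  fix g' assume inv': "inverse_mor (semisimple_category S) A B f g'"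
  note d = inv[unfolded inverse_mor_def semisimple_category_def, simplified]
    inv'[unfolded inverse_mor_def semisimple_category_def, simplified]
  have "g' = mat_comp (mat_comp g f) g'" using d mat_comp_diag_left[of g' B A] assms by simp
  also have "\<dots> = mat_comp g (mat_comp f g')" using d assms mat_comp_assoc[of A B f g' B g] by simp
  also have "\<dots> = g" using d mat_comp_diag_right[of g B A] by simp
  finally show "g' = g" .
qed

text \<open>The part of \<open>mat_hom\<close> that forgets source and target. It passes through
  composites without any finiteness or typing conditions, which suits the long composite defining
  the counit.\<close>

definition graded :: "('l, 'k::zero) matrix \<Rightarrow> bool" where
  "graded f \<longleftrightarrow> (\<forall>y x. f y x \<noteq> 0 \<longrightarrow> label y = label x)"

lemma graded_hom: "f \<in> mat_hom A B \<Longrightarrow> graded f"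
  by (auto simp: graded_def mat_hom_def)

lemma graded_comp: "graded f \<Longrightarrow> graded g \<Longrightarrow> graded (mat_comp f g)"
  unfolding graded_def by (metis mat_comp_nonzeroE)

lemma graded_tensor: "graded (mat_tensor S f g)"
  unfolding graded_def mat_tensor_def by (auto split: summand.splits if_splits)

lemma graded_braid: "graded (mat_braid S A B)"
  unfolding graded_def mat_braid_def by (auto split: summand.splits if_splits)

lemma mat_tensor_nonzeroE:
  assumes "mat_tensor S f g t s \<noteq> 0"
  obtains x' y' x y c where "t = Fuse x' y' c" "s = Fuse x y c" "c \<in> simples S"
    "fuses S (label x) (label y) c" "f x' x \<noteq> 0" "g y' y \<noteq> 0"
  using assms unfolding mat_tensor_def
  by (auto split: summand.splits if_splits) (metis mult_not_zero)

lemma mat_tensor_Fuse: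
  "mat_tensor S f g (Fuse x' y' c') (Fuse x y c) =
     (if c' = c \<and> c \<in> simples S \<and> fuses S (label x) (label y) c then f x' x * g y' y else 0)"
  by (simp add: mat_tensor_def)

lemma mat_diag_nonzeroD: "mat_diag d A y x \<noteq> 0 \<Longrightarrow> y = x \<and> x \<in> A"
  by (auto simp: mat_diag_def split: if_splits)

lemma Fuse_mem_sum_tensor:
  "Fuse x y c \<in> sum_tensor S A B \<longleftrightarrow> x \<in> A \<and> y \<in> B \<and> c \<in> simples S \<and> fuses S (label x) (label y) c"
  by (auto simp: sum_tensor_def)

lemma sum_tensorE:
  assumes "s \<in> sum_tensor S A B"
  obtains x y c where "s = Fuse x y c" "x \<in> A" "y \<in> B" "c \<in> simples S" "fuses S (label x) (label y) c"
  using assms by (auto simp: sum_tensor_def)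

lemma Summand_notin_sum_tensor [simp]: "Summand a n \<notin> sum_tensor S A B"
  by (auto simp: sum_tensor_def)

section \<open>Inverses of the structure maps\<close>

text \<open>The last two conditions say that each associativity block squares to the identity. The
  second factor reads its coefficient with the two intermediate labels exchanged, possibly at a pair
  that fusion does not admit, so the values of the coefficient function there matter too.\<close>

locale involutive_fusion =
  fixes S :: "('l, 'k::field) fusion_data"
  assumes finite_simples: "finite (simples S)"
    and unit_mem: "unit_simple S \<in> simples S"
    and fuses_unit_left:
      "\<lbrakk>b \<in> simples S; c \<in> simples S\<rbrakk> \<Longrightarrow> fuses S (unit_simple S) b c \<longleftrightarrow> c = b"
    and fuses_unit_right:
      "\<lbrakk>b \<in> simples S; c \<in> simples S\<rbrakk> \<Longrightarrow> fuses S b (unit_simple S) c \<longleftrightarrow> c = b"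
    and fuses_commute: "fuses S a b c \<longleftrightarrow> fuses S b a c"
    and assoc_unit_left: "assoc_coeff S (unit_simple S) b c d f e = 1"
    and braid_unit_right: "braid_coeff S a (unit_simple S) c = 1"
    and assoc_involutive_left:
      "\<lbrakk>a \<in> simples S; b \<in> simples S; c \<in> simples S; d \<in> simples S; f \<in> simples S; f' \<in> simples S;
        fuses S b c f; fuses S a f d; fuses S b c f'; fuses S a f' d\<rbrakk>
       \<Longrightarrow> (\<Sum>e | e \<in> simples S \<and> fuses S a b e \<and> fuses S e c d.
             assoc_coeff S a b c d f e * assoc_coeff S a b c d e f') = (if f = f' then 1 else 0)"
    and assoc_involutive_right:
      "\<lbrakk>a \<in> simples S; b \<in> simples S; c \<in> simples S; d \<in> simples S; e \<in> simples S; e' \<in> simples S;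
        fuses S a b e; fuses S e c d; fuses S a b e'; fuses S e' c d\<rbrakk>
       \<Longrightarrow> (\<Sum>f | f \<in> simples S \<and> fuses S b c f \<and> fuses S a f d.
             assoc_coeff S a b c d e f * assoc_coeff S a b c d f e') = (if e = e' then 1 else 0)"
begin

abbreviation "C \<equiv> semisimple_category S"
abbreviation "unit_summand \<equiv> Summand (unit_simple S) 0"

lemma C_simps [simp]:
  "Obj C = {A. finite A \<and> label ` A \<subseteq> simples S}" "Hom C = mat_hom" "Id C = mat_diag (\<lambda>x. 1)"
  "Comp C = mat_comp" "Zero C = (\<lambda>A B y x. 0)" "Unit C = {unit_summand}" "Tensor C = sum_tensor S"
  "TensorM C = mat_tensor S" "Assoc C = mat_assoc S" "LUnit C = mat_lunit S" "RUnit C = mat_runit S"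
  "Braid C = mat_braid S" "Twist C = mat_diag (\<lambda>x. twist_coeff S (label x))"
  by (simp_all add: semisimple_category_def)

lemma finite_sum_tensor: "finite A \<Longrightarrow> finite B \<Longrightarrow> finite (sum_tensor S A B)"
proof -
  assume "finite A" "finite B"
  then have "finite ((\<lambda>(x, y, c). Fuse x y c) ` (A \<times> B \<times> simples S))"
    using finite_simples by blast
  moreover have "sum_tensor S A B \<subseteq> (\<lambda>(x, y, c). Fuse x y c) ` (A \<times> B \<times> simples S)"
    by (auto simp: sum_tensor_def image_iff)
  ultimately show ?thesis by (rule finite_subset[rotated])
qed

lemma RUnitInv_eq:
  assumes A: "finite A" "label ` A \<subseteq> simples S"
  shows "RUnitInv C A = (\<lambda>s x. mat_runit S A x s)" (is "_ = ?g")
proof -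
  let ?f = "mat_runit S A :: ('l, 'k) matrix"
  have f: "?f \<in> mat_hom (sum_tensor S A {unit_summand}) A"
    using A by (auto simp: mat_hom_def mat_runit_def Fuse_mem_sum_tensor fuses_unit_right unit_mem split: if_splits)
  have g: "?g \<in> mat_hom A (sum_tensor S A {unit_summand})"
    using f by (auto simp: mat_hom_def)
  have fg: "mat_comp ?f ?g = mat_diag (\<lambda>x. 1) A"
  proof (intro ext)
    fix z x
    have "mat_comp ?f ?g z x = ?f z (Fuse x unit_summand (label x)) * ?g (Fuse x unit_summand (label x)) x"
      by (rule mat_comp_single) (auto simp: mat_runit_def split: if_splits)
    then show "mat_comp ?f ?g z x = mat_diag (\<lambda>x. 1) A z x"
      by (auto simp: mat_runit_def mat_diag_def)
  qed
  have gf: "mat_comp ?g ?f = mat_diag (\<lambda>x. 1) (sum_tensor S A {unit_summand})"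
  proof (intro ext)
    fix t s :: "'l summand"
    show "mat_comp ?g ?f t s = mat_diag (\<lambda>x. 1) (sum_tensor S A {unit_summand}) t s"
    proof (cases "s \<in> sum_tensor S A {unit_summand}")
      case False
      then have "mat_comp ?g ?f t s = 0" using f by (intro mat_comp_zero) (meson mat_homD(2))
      then show ?thesis using False by (simp add: mat_diag_def)
    next
      case True
      then obtain x where x: "s = Fuse x unit_summand (label x)" "x \<in> A"
        using A by (auto elim!: sum_tensorE simp: fuses_unit_right)
      have "mat_comp ?g ?f t s = ?g t x * ?f x s"
        by (rule mat_comp_single) (auto simp: x mat_runit_def split: if_splits)
      then show ?thesis using True by (auto simp: x mat_runit_def mat_diag_def)
    qed
  qed
  show ?thesis
    by (rule inv_mor_semisimple)
      (use A f g fg gf in \<open>auto simp: inverse_mor_def finite_sum_tensor\<close>)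
qed

text \<open>The inverse is built from the same coefficients as the associator, with only the
  intermediate labels \<open>e\<close> and \<open>f\<close> exchanged in their arguments; this is
  where the involution property is exploited.\<close>

definition mat_assoc_inv ::
  "'l summand set \<Rightarrow> 'l summand set \<Rightarrow> 'l summand set \<Rightarrow> ('l, 'k) matrix" where
  "mat_assoc_inv A B D = (\<lambda>s t.
     if t \<in> sum_tensor S A (sum_tensor S B D) \<and> s \<in> sum_tensor S (sum_tensor S A B) D then
       (case (t, s) of
          (Fuse x' (Fuse y' z' f) d', Fuse (Fuse x y e) z d) \<Rightarrow>
            if x' = x \<and> y' = y \<and> z' = z \<and> d' = d
            then assoc_coeff S (label x) (label y) (label z) d e f else 0
        | _ \<Rightarrow> 0)
     else 0)"

lemma mat_assoc_inv_nonzeroE: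
  assumes "mat_assoc_inv A B D s t \<noteq> 0"
  obtains x y z e f d where "s = Fuse (Fuse x y e) z d" "t = Fuse x (Fuse y z f) d"
  using assms unfolding mat_assoc_inv_def by (auto split: summand.splits if_splits)

lemma mat_assoc_nonzeroE:
  assumes "mat_assoc S A B D t s \<noteq> 0"
  obtains x y z e f d where "s = Fuse (Fuse x y e) z d" "t = Fuse x (Fuse y z f) d"
    "x \<in> A" "y \<in> B" "z \<in> D" "d \<in> simples S" "f \<in> simples S" "e \<in> simples S"
    "fuses S (label y) (label z) f" "fuses S (label x) f d"
    "fuses S (label x) (label y) e" "fuses S e (label z) d"
  using assms unfolding mat_assoc_def
  by (auto simp: Fuse_mem_sum_tensor split: summand.splits if_splits)

lemma AssocInv_eq:
  assumes A: "finite A" "label ` A \<subseteq> simples S" and B: "finite B" "label ` B \<subseteq> simples S"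
    and D: "finite D" "label ` D \<subseteq> simples S"
  shows "AssocInv C A B D = mat_assoc_inv A B D"
proof -
  let ?P = "sum_tensor S (sum_tensor S A B) D" and ?Q = "sum_tensor S A (sum_tensor S B D)"
  let ?f = "mat_assoc S A B D :: ('l, 'k) matrix" and ?g = "mat_assoc_inv A B D"
  have f: "?f \<in> mat_hom ?P ?Q"
    by (rule mat_homI) (auto elim!: mat_assoc_nonzeroE simp: Fuse_mem_sum_tensor)
  have g: "?g \<in> mat_hom ?Q ?P"
    unfolding mat_assoc_inv_def by (rule mat_homI) (auto split: summand.splits if_splits)
  have gf: "mat_comp ?g ?f = mat_diag (\<lambda>x. 1) ?P"
  proof (intro ext)
    fix t s
    show "mat_comp ?g ?f t s = mat_diag (\<lambda>x. 1) ?P t s"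
    proof (cases "s \<in> ?P")
      case False
      then have "mat_comp ?g ?f t s = 0" using f by (intro mat_comp_zero) (meson mat_homD(2))
      then show ?thesis using False by (simp add: mat_diag_def)
    next
      case True
      then obtain x y e z d where s: "s = Fuse (Fuse x y e) z d" and mem: "x \<in> A" "y \<in> B" "z \<in> D"
        "e \<in> simples S" "d \<in> simples S" "fuses S (label x) (label y) e" "fuses S e (label z) d"
        by (auto elim!: sum_tensorE)
      then have lab: "label x \<in> simples S" "label y \<in> simples S" "label z \<in> simples S"
        using A B D by auto
      let ?K = "{c \<in> simples S. fuses S (label y) (label z) c \<and> fuses S (label x) c d}"
      let ?h = "\<lambda>c. Fuse x (Fuse y z c) d"
      have eq: "mat_comp ?g ?f t s = (\<Sum>c\<in>?K. ?g t (?h c) * ?f (?h c) s)"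
        by (rule mat_comp_reindex) (auto simp: finite_simples inj_on_def s elim!: mat_assoc_nonzeroE)
      show ?thesis
      proof (cases "\<exists>e'. t = Fuse (Fuse x y e') z d \<and> t \<in> ?P")
        case False
        then have "?g t (?h c) = 0" for c
          unfolding mat_assoc_inv_def by (auto split: summand.splits if_splits)
        then show ?thesis using False True eq by (auto simp: mat_diag_def s)
      next
        case True
        then obtain e' where t: "t = Fuse (Fuse x y e') z d" "t \<in> ?P" by auto
        then have mem': "e' \<in> simples S" "fuses S (label x) (label y) e'" "fuses S e' (label z) d"
          by (auto simp: Fuse_mem_sum_tensor)
        have "mat_comp ?g ?f t s = (\<Sum>c\<in>?K. assoc_coeff S (label x) (label y) (label z) d e' c
            * assoc_coeff S (label x) (label y) (label z) d c e)"
          unfolding eq by (rule sum.cong)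
            (use mem mem' in \<open>auto simp: s t mat_assoc_def mat_assoc_inv_def Fuse_mem_sum_tensor\<close>)
        also have "\<dots> = (if e' = e then 1 else 0)"
          using assoc_involutive_right[OF lab mem(5) mem'(1) mem(4) mem'(2,3) mem(6,7)] by simp
        finally show ?thesis using t by (auto simp: s mat_diag_def)
      qed
    qed
  qed
  have fg: "mat_comp ?f ?g = mat_diag (\<lambda>x. 1) ?Q"
  proof (intro ext)
    fix t s
    show "mat_comp ?f ?g t s = mat_diag (\<lambda>x. 1) ?Q t s"
    proof (cases "s \<in> ?Q")
      case False
      then have "mat_comp ?f ?g t s = 0" using g by (intro mat_comp_zero) (meson mat_homD(2))
      then show ?thesis using False by (simp add: mat_diag_def)
    next
      case True
      then obtain x y c z d where s: "s = Fuse x (Fuse y z c) d" and mem: "x \<in> A" "y \<in> B" "z \<in> D"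
        "c \<in> simples S" "d \<in> simples S" "fuses S (label y) (label z) c" "fuses S (label x) c d"
        by (auto elim!: sum_tensorE)
      then have lab: "label x \<in> simples S" "label y \<in> simples S" "label z \<in> simples S"
        using A B D by auto
      let ?K = "{e \<in> simples S. fuses S (label x) (label y) e \<and> fuses S e (label z) d}"
      let ?h = "\<lambda>e. Fuse (Fuse x y e) z d"
      have eq: "mat_comp ?f ?g t s = (\<Sum>e\<in>?K. ?f t (?h e) * ?g (?h e) s)"
      proof (rule mat_comp_reindex)
        fix r assume r: "?g r s \<noteq> 0"
        then obtain e where e: "r = ?h e" by (auto simp: s elim!: mat_assoc_inv_nonzeroE)
        with mat_homD(1)[OF g r] show "r \<in> ?h ` ?K" by (auto simp: Fuse_mem_sum_tensor)
      qed (auto simp: finite_simples inj_on_def)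
      show ?thesis
      proof (cases "\<exists>c'. t = Fuse x (Fuse y z c') d \<and> t \<in> ?Q")
        case False
        then have "?f t (?h e) = 0" for e
          unfolding mat_assoc_def by (auto split: summand.splits if_splits)
        then show ?thesis using False True eq by (auto simp: mat_diag_def s)
      next
        case True
        then obtain c' where t: "t = Fuse x (Fuse y z c') d" "t \<in> ?Q" by auto
        then have mem': "c' \<in> simples S" "fuses S (label y) (label z) c'" "fuses S (label x) c' d"
          by (auto simp: Fuse_mem_sum_tensor)
        have "mat_comp ?f ?g t s = (\<Sum>e\<in>?K. assoc_coeff S (label x) (label y) (label z) d c' e
            * assoc_coeff S (label x) (label y) (label z) d e c)"
          unfolding eq by (rule sum.cong)
            (use mem mem' in \<open>auto simp: s t mat_assoc_def mat_assoc_inv_def Fuse_mem_sum_tensor\<close>)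
        also have "\<dots> = (if c' = c then 1 else 0)"
          using assoc_involutive_left[OF lab mem(5) mem'(1) mem(4) mem'(2,3) mem(6,7)] by simp
        finally show ?thesis using t by (auto simp: s mat_diag_def)
      qed
    qed
  qed
  show ?thesis
    by (rule inv_mor_semisimple)
      (use A B D f g fg gf in \<open>auto simp: inverse_mor_def finite_sum_tensor\<close>)
qed

lemma graded_runit_inv: "graded (\<lambda>s x. mat_runit S A x s)"
  by (auto simp: graded_def mat_runit_def)

lemma graded_assoc_inv: "graded (mat_assoc_inv A B D)"
  unfolding graded_def by (auto elim!: mat_assoc_inv_nonzeroE)

end

section \<open>Algebras in coordinates\<close>

text \<open>The structure constant of \<open>z\<close> in the product of \<open>x\<close> and
  \<open>y\<close>. By Schur's lemma the only relevant column has label \<open>label z\<close>, and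
  multiplicity-freeness leaves exactly one such column.\<close>

definition mult :: "('l, 'k) matrix \<Rightarrow> 'l summand \<Rightarrow> 'l summand \<Rightarrow> 'l summand \<Rightarrow> 'k" where
  "mult m z x y = m z (Fuse x y (label z))"

context involutive_fusion
begin

lemma mult_nonzeroD:
  assumes "m \<in> mat_hom (sum_tensor S A A) A" "mult m z x y \<noteq> 0"
  shows "z \<in> A" "x \<in> A" "y \<in> A" "label z \<in> simples S" "fuses S (label x) (label y) (label z)"
  using mat_homD[OF assms(1), of z "Fuse x y (label z)"] assms(2)
  by (auto simp: mult_def Fuse_mem_sum_tensor)

lemma mult_eq_matrix:
  assumes "m \<in> mat_hom (sum_tensor S A A) A"
  shows "m z s \<noteq> 0 \<Longrightarrow> \<exists>x y. s = Fuse x y (label z)"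
  using mat_homD[OF assms, of z s] by (auto simp: sum_tensor_def)

lemma comp_tensor_left:
  assumes m: "m \<in> mat_hom (sum_tensor S A A) A" and A: "finite A"
  shows "mat_comp m (mat_tensor S m (mat_diag (\<lambda>x. 1) A)) z s =
    (case s of Fuse (Fuse x y e) t d \<Rightarrow>
       if t \<in> A \<and> d = label z \<and> d \<in> simples S \<and> fuses S e (label t) d
       then \<Sum>e' | e' \<in> A \<and> label e' = e. mult m z e' t * mult m e' x y else 0
     | _ \<Rightarrow> 0)"
proof (cases "\<exists>x y e t d. s = Fuse (Fuse x y e) t d")
  case False
  have "mat_tensor S m (mat_diag (\<lambda>x. 1) A) r s = 0" for r
    by (rule ccontr) (use False mult_eq_matrix[OF m] in \<open>auto elim!: mat_tensor_nonzeroE; metis\<close>)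
  then have "mat_comp m (mat_tensor S m (mat_diag (\<lambda>x. 1) A)) z s = 0" by (rule mat_comp_zero)
  then show ?thesis using False by (auto split: summand.splits)
next
  case True
  then obtain x y e t d where s: "s = Fuse (Fuse x y e) t d" by blast
  let ?T = "mat_tensor S m (mat_diag (\<lambda>x. 1) A)"
  have "mat_comp m ?T z s = (\<Sum>e' | e' \<in> A \<and> label e' = e. m z (Fuse e' t d) * ?T (Fuse e' t d) s)"
    by (rule mat_comp_reindex)
      (use A mat_homD[OF m] in \<open>auto simp: inj_on_def s image_iff elim!: mat_tensor_nonzeroE dest!: mat_diag_nonzeroD\<close>)
  also have "\<dots> = (if t \<in> A \<and> d = label z \<and> d \<in> simples S \<and> fuses S e (label t) d
       then \<Sum>e' | e' \<in> A \<and> label e' = e. mult m z e' t * mult m e' x y else 0)"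
  proof (cases "d = label z")
    case True
    then show ?thesis
      by (auto simp: s mat_tensor_Fuse mat_diag_def mult_def intro!: sum.cong sum.neutral)
  next
    case False
    then have "m z (Fuse e' t d) = 0" for e' using mat_homD(3)[OF m, of z "Fuse e' t d"] by auto
    then show ?thesis using False by simp
  qed
  finally show ?thesis by (simp add: s)
qed

lemma comp_tensor_right:
  assumes m: "m \<in> mat_hom (sum_tensor S A A) A" and A: "finite A" "label ` A \<subseteq> simples S"
  shows "mat_comp m (mat_comp (mat_tensor S (mat_diag (\<lambda>x. 1) A) m) (mat_assoc S A A A)) z s =
    (case s of Fuse (Fuse x y e) t d \<Rightarrow>
       if s \<in> sum_tensor S (sum_tensor S A A) A \<and> d = label z
       then \<Sum>f\<in>A. assoc_coeff S (label x) (label y) (label t) (label z) (label f) e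
                      * (mult m z x f * mult m f y t) else 0
     | _ \<Rightarrow> 0)"
proof -
  let ?T = "mat_tensor S (mat_diag (\<lambda>x. 1) A) m" and ?a = "mat_assoc S A A A :: ('l, 'k) matrix"
  show ?thesis
  proof (cases "s \<in> sum_tensor S (sum_tensor S A A) A")
    case False
    have "?a r s = 0" for r using False by (simp add: mat_assoc_def)
    then have "mat_comp m (mat_comp ?T ?a) z s = 0" by (intro mat_comp_zero) simp
    then show ?thesis using False by (auto split: summand.splits)
  next
    case True
    then obtain x y e t d where s: "s = Fuse (Fuse x y e) t d" and mem: "x \<in> A" "y \<in> A" "t \<in> A"
      "e \<in> simples S" "d \<in> simples S" "fuses S (label x) (label y) e" "fuses S e (label t) d"
      by (auto elim!: sum_tensorE)
    \<comment> \<open>The associator spreads \<open>s\<close> over all intermediate labels;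
      multiplying into the summand \<open>f\<close> keeps only the label of
      \<open>f\<close>.\<close>
    have inner: "mat_comp ?T ?a (Fuse x f d) s =
        (if fuses S (label x) (label f) d
         then assoc_coeff S (label x) (label y) (label t) d (label f) e * mult m f y t else 0)"
      if f: "f \<in> A" for f
    proof -
      let ?r = "Fuse x (Fuse y t (label f)) d"
      have sup: "?a r s \<noteq> 0 \<Longrightarrow> r \<in> (\<lambda>c. Fuse x (Fuse y t c) d) ` simples S" for r
        by (auto elim!: mat_assoc_nonzeroE simp: s)
      have "mat_comp ?T ?a (Fuse x f d) s =
          (\<Sum>c\<in>simples S. ?T (Fuse x f d) (Fuse x (Fuse y t c) d) * ?a (Fuse x (Fuse y t c) d) s)"
        by (rule mat_comp_reindex) (use sup in \<open>auto simp: inj_on_def finite_simples\<close>)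
      also have "\<dots> = (\<Sum>c\<in>simples S. if c = label f then ?T (Fuse x f d) ?r * ?a ?r s else 0)"
      proof (rule sum.cong[OF refl])
        fix c assume "c \<in> simples S"
        have "m f (Fuse y t c) = 0" if "c \<noteq> label f" using mat_homD(3)[OF m, of f "Fuse y t c"] that by auto
        then show "?T (Fuse x f d) (Fuse x (Fuse y t c) d) * ?a (Fuse x (Fuse y t c) d) s =
            (if c = label f then ?T (Fuse x f d) ?r * ?a ?r s else 0)"
          by (auto simp: mat_tensor_Fuse)
      qed
      also have "\<dots> = ?T (Fuse x f d) ?r * ?a ?r s"
        using f A by (auto simp: finite_simples)
      also have "\<dots> = (if fuses S (label x) (label f) d
         then assoc_coeff S (label x) (label y) (label t) d (label f) e * mult m f y t else 0)"
        using mem f A mult_nonzeroD[OF m, of f y t] True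
        by (cases "mult m f y t = 0")
          (auto simp: mat_tensor_Fuse mat_diag_def mat_assoc_def s Fuse_mem_sum_tensor mult_def)
      finally show ?thesis .
    qed
    have "mat_comp m (mat_comp ?T ?a) z s = (\<Sum>f\<in>A. m z (Fuse x f d) * mat_comp ?T ?a (Fuse x f d) s)"
    proof (rule mat_comp_reindex)
      fix r assume "mat_comp ?T ?a r s \<noteq> 0"
      then show "r \<in> (\<lambda>f. Fuse x f d) ` A" using mat_homD(1)[OF m]
        by (auto simp: s elim!: mat_comp_nonzeroE mat_tensor_nonzeroE mat_assoc_nonzeroE dest!: mat_diag_nonzeroD)
    qed (auto simp: inj_on_def A)
    also have "\<dots> = (if d = label z then \<Sum>f\<in>A. assoc_coeff S (label x) (label y) (label t) (label z) (label f) e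
                      * (mult m z x f * mult m f y t) else 0)"
    proof (cases "d = label z")
      case False
      then have "m z (Fuse x f d) = 0" for f using mat_homD(3)[OF m, of z "Fuse x f d"] by auto
      then show ?thesis using False by simp
    next
      case d: True
      show ?thesis unfolding if_P[OF d]
      proof (rule sum.cong[OF refl])
        fix f assume "f \<in> A"
        then show "m z (Fuse x f d) * mat_comp ?T ?a (Fuse x f d) s =
          assoc_coeff S (label x) (label y) (label t) (label z) (label f) e * (mult m z x f * mult m f y t)"
          using mult_nonzeroD(5)[OF m, of z x f] d inner[of f]
          by (cases "mult m z x f = 0") (auto simp: mult_def)
      qed
    qed
    finally show ?thesis using True by (simp add: s)
  qed
qed

lemma comp_unit_left:
  assumes m: "m \<in> mat_hom (sum_tensor S A A) A" and i: "i \<in> mat_hom {unit_summand} A" 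
    and A: "finite A" "label ` A \<subseteq> simples S"
  shows "mat_comp m (mat_tensor S i (mat_diag (\<lambda>x. 1) A)) z s =
    (case s of Fuse p x d \<Rightarrow>
       if p = unit_summand \<and> x \<in> A \<and> d = label x \<and> d = label z
       then \<Sum>a\<in>A. mult m z a x * i a unit_summand else 0
     | _ \<Rightarrow> 0)"
proof -
  let ?T = "mat_tensor S i (mat_diag (\<lambda>x. 1) A)"
  show ?thesis
  proof (cases "\<exists>x. s = Fuse unit_summand x (label x) \<and> x \<in> A \<and> label x = label z")
    case False
    have "m z r * ?T r s = 0" for r
    proof (rule ccontr)
      assume ne: "\<not> ?thesis"
      then have nzT: "?T r s \<noteq> 0" and mz: "m z r \<noteq> 0" by auto
      obtain x' y' x y c where r: "r = Fuse x' y' c" and s: "s = Fuse x y c" "c \<in> simples S"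
        "fuses S (label x) (label y) c" and nz: "i x' x \<noteq> 0" "mat_diag (\<lambda>x. 1) A y' y \<noteq> (0::'k)"
        by (rule mat_tensor_nonzeroE[OF nzT]) blast
      have "x = unit_summand" "y \<in> A" using nz mat_homD(2)[OF i] by (auto dest!: mat_diag_nonzeroD)
      moreover have "label z = c" using mat_homD(3)[OF m mz] r by simp
      ultimately show False using False A s by (auto simp: fuses_unit_left image_subset_iff)
    qed
    then have "mat_comp m ?T z s = 0" by (rule mat_comp_zero_products)
    then show ?thesis using False by (auto split: summand.splits)
  next
    case True
    then obtain x where s: "s = Fuse unit_summand x (label x)" "x \<in> A" "label x = label z" by blast
    have "mat_comp m ?T z s = (\<Sum>a\<in>A. m z (Fuse a x (label x)) * ?T (Fuse a x (label x)) s)"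
      by (rule mat_comp_reindex)
        (use A mat_homD[OF i] in \<open>auto simp: inj_on_def s elim!: mat_tensor_nonzeroE dest!: mat_diag_nonzeroD\<close>)
    also have "\<dots> = (\<Sum>a\<in>A. mult m z a x * i a unit_summand)"
      using A s by (intro sum.cong) (auto simp: mat_tensor_Fuse mat_diag_def mult_def fuses_unit_left image_subset_iff)
    finally show ?thesis by (simp add: s)
  qed
qed

lemma comp_unit_right:
  assumes m: "m \<in> mat_hom (sum_tensor S A A) A" and i: "i \<in> mat_hom {unit_summand} A" 
    and A: "finite A" "label ` A \<subseteq> simples S"
  shows "mat_comp m (mat_tensor S (mat_diag (\<lambda>x. 1) A) i) z s =
    (case s of Fuse x p d \<Rightarrow>
       if p = unit_summand \<and> x \<in> A \<and> d = label x \<and> d = label z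
       then \<Sum>a\<in>A. mult m z x a * i a unit_summand else 0
     | _ \<Rightarrow> 0)"
proof -
  let ?T = "mat_tensor S (mat_diag (\<lambda>x. 1) A) i"
  show ?thesis
  proof (cases "\<exists>x. s = Fuse x unit_summand (label x) \<and> x \<in> A \<and> label x = label z")
    case False
    have "m z r * ?T r s = 0" for r
    proof (rule ccontr)
      assume ne: "\<not> ?thesis"
      then have nzT: "?T r s \<noteq> 0" and mz: "m z r \<noteq> 0" by auto
      obtain x' y' x y c where r: "r = Fuse x' y' c" and s: "s = Fuse x y c" "c \<in> simples S"
        "fuses S (label x) (label y) c" and nz: "mat_diag (\<lambda>x. 1) A x' x \<noteq> (0::'k)" "i y' y \<noteq> 0"
        by (rule mat_tensor_nonzeroE[OF nzT]) blast
      have "y = unit_summand" "x \<in> A" using nz mat_homD(2)[OF i] by (auto dest!: mat_diag_nonzeroD)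
      moreover have "label z = c" using mat_homD(3)[OF m mz] r by simp
      ultimately show False using False A s by (auto simp: fuses_unit_right image_subset_iff)
    qed
    then have "mat_comp m ?T z s = 0" by (rule mat_comp_zero_products)
    then show ?thesis using False by (auto split: summand.splits)
  next
    case True
    then obtain x where s: "s = Fuse x unit_summand (label x)" "x \<in> A" "label x = label z" by blast
    have "mat_comp m ?T z s = (\<Sum>a\<in>A. m z (Fuse x a (label x)) * ?T (Fuse x a (label x)) s)"
      by (rule mat_comp_reindex)
        (use A mat_homD[OF i] in \<open>auto simp: inj_on_def s elim!: mat_tensor_nonzeroE dest!: mat_diag_nonzeroD\<close>)
    also have "\<dots> = (\<Sum>a\<in>A. mult m z x a * i a unit_summand)"
      using A s by (intro sum.cong) (auto simp: mat_tensor_Fuse mat_diag_def mult_def fuses_unit_right image_subset_iff)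
    finally show ?thesis by (simp add: s)
  qed
qed

text \<open>Associativity is stated separately for each intermediate label \<open>e\<close> of the
  product of \<open>x\<close> and \<open>y\<close>. The left sum sees only the summands labelled
  \<open>e\<close>, while the right sum sees all of \<open>A\<close>, weighted by the
  associator.\<close>

definition algebra_coords :: "'l summand set \<Rightarrow> ('l, 'k) matrix \<Rightarrow> ('l, 'k) matrix \<Rightarrow> bool" where
  "algebra_coords A m i \<longleftrightarrow> finite A \<and> label ` A \<subseteq> simples S \<and>
     m \<in> mat_hom (sum_tensor S A A) A \<and> i \<in> mat_hom {unit_summand} A \<and>
     (\<forall>x\<in>A. \<forall>y\<in>A. \<forall>t\<in>A. \<forall>z\<in>A. \<forall>e\<in>simples S.
        fuses S (label x) (label y) e \<and> fuses S e (label t) (label z) \<longrightarrow>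
        (\<Sum>e' | e' \<in> A \<and> label e' = e. mult m z e' t * mult m e' x y) =
        (\<Sum>f\<in>A. assoc_coeff S (label x) (label y) (label t) (label z) (label f) e
                  * (mult m z x f * mult m f y t))) \<and>
     (\<forall>x\<in>A. \<forall>z\<in>A. (\<Sum>a\<in>A. mult m z a x * i a unit_summand) = (if z = x then 1 else 0)) \<and>
     (\<forall>x\<in>A. \<forall>z\<in>A. (\<Sum>a\<in>A. mult m z x a * i a unit_summand) = (if z = x then 1 else 0))"

text \<open>The forward direction extracts equations from a given algebra. The backward direction
  certifies that a quotient built by hand is an algebra, so that simplicity can be applied to
  it.\<close>

lemma is_algebra_iff: "is_algebra C A m i \<longleftrightarrow> algebra_coords A m i"
proof
  assume alg: "is_algebra C A m i"
  then have A: "finite A" "label ` A \<subseteq> simples S" and m: "m \<in> mat_hom (sum_tensor S A A) A"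
    and i: "i \<in> mat_hom {unit_summand} A"
    by (auto simp: is_algebra_def)
  have eqs: "mat_comp m (mat_tensor S m (mat_diag (\<lambda>x. 1) A)) =
      mat_comp m (mat_comp (mat_tensor S (mat_diag (\<lambda>x. 1) A) m) (mat_assoc S A A A))"
    "mat_comp m (mat_tensor S i (mat_diag (\<lambda>x. 1) A)) = mat_lunit S A"
    "mat_comp m (mat_tensor S (mat_diag (\<lambda>x. 1) A) i) = mat_runit S A"
    using alg by (auto simp: is_algebra_def)
  have "(\<Sum>a\<in>A. mult m z a x * i a unit_summand) = (if z = x then 1 else 0)" 
    "(\<Sum>a\<in>A. mult m z x a * i a unit_summand) = (if z = x then 1 else 0)" if "x \<in> A" "z \<in> A" for x z
  proof -
    \<comment> \<open>For different labels the matrix equations give no information about these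
      sums; they vanish because multiplying by the unit component preserves labels.\<close>
    have *: "(\<Sum>a\<in>A. mult m z a x * i a unit_summand) = 0" "(\<Sum>a\<in>A. mult m z x a * i a unit_summand) = 0"
      if "label z \<noteq> label x"
    proof -
      have prod0: "mult m z a x * i a unit_summand = 0 \<and> mult m z x a * i a unit_summand = 0" for a
      proof (cases "i a unit_summand = 0")
        case False
        then have "label a = unit_simple S" using mat_homD(3)[OF i] by fastforce
        then show ?thesis using mult_nonzeroD[OF m, of z] that fuses_unit_left fuses_unit_right A 
          by (metis image_subset_iff mult_zero_left)
      qed simp
      show "(\<Sum>a\<in>A. mult m z a x * i a unit_summand) = 0" "(\<Sum>a\<in>A. mult m z x a * i a unit_summand) = 0"
        by (intro sum.neutral ballI prod0[THEN conjunct1] prod0[THEN conjunct2])+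
    qed
    have "mat_comp m (mat_tensor S i (mat_diag (\<lambda>x. 1) A)) z (Fuse unit_summand x (label x)) =
        mat_lunit S A z (Fuse unit_summand x (label x))"
      "mat_comp m (mat_tensor S (mat_diag (\<lambda>x. 1) A) i) z (Fuse x unit_summand (label x)) =
        mat_runit S A z (Fuse x unit_summand (label x))"
      using eqs by simp_all
    then show "(\<Sum>a\<in>A. mult m z a x * i a unit_summand) = (if z = x then 1 else 0)"
      "(\<Sum>a\<in>A. mult m z x a * i a unit_summand) = (if z = x then 1 else 0)"
      using that * by (auto simp: comp_unit_left[OF m i A] comp_unit_right[OF m i A] mat_lunit_def mat_runit_def
          split: if_splits)
  qed
  moreover have "(\<Sum>e' | e' \<in> A \<and> label e' = e. mult m z e' t * mult m e' x y) =
        (\<Sum>f\<in>A. assoc_coeff S (label x) (label y) (label t) (label z) (label f) e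
                  * (mult m z x f * mult m f y t))"
    if "x \<in> A" "y \<in> A" "t \<in> A" "z \<in> A" "e \<in> simples S" 
      "fuses S (label x) (label y) e" "fuses S e (label t) (label z)" for x y t z e
    using fun_cong[OF fun_cong[OF eqs(1)], of z "Fuse (Fuse x y e) t (label z)"] that A
    by (auto simp: comp_tensor_left[OF m A(1)] comp_tensor_right[OF m A] Fuse_mem_sum_tensor image_subset_iff)
  ultimately show "algebra_coords A m i" using A m i by (simp add: algebra_coords_def)
next
  assume alg: "algebra_coords A m i"
  then have A: "finite A" "label ` A \<subseteq> simples S" and m: "m \<in> mat_hom (sum_tensor S A A) A"
    and i: "i \<in> mat_hom {unit_summand} A"
    by (auto simp: algebra_coords_def)
  have assoc: "(\<Sum>e' | e' \<in> A \<and> label e' = e. mult m z e' t * mult m e' x y) =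
        (\<Sum>f\<in>A. assoc_coeff S (label x) (label y) (label t) (label z) (label f) e
                  * (mult m z x f * mult m f y t))"
    if "x \<in> A" "y \<in> A" "t \<in> A" "z \<in> A" "e \<in> simples S" 
      "fuses S (label x) (label y) e" "fuses S e (label t) (label z)" for x y t z e
    using alg that unfolding algebra_coords_def by blast
  have un: "(\<Sum>a\<in>A. mult m z a x * i a unit_summand) = (if z = x then 1 else 0)" 
    "(\<Sum>a\<in>A. mult m z x a * i a unit_summand) = (if z = x then 1 else 0)" if "x \<in> A" "z \<in> A" for x z
    using alg that unfolding algebra_coords_def by blast+
  have un0: "(\<Sum>a\<in>A. mult m z a x * i a unit_summand) = 0" 
    "(\<Sum>a\<in>A. mult m z x a * i a unit_summand) = 0" if "z \<notin> A" for x z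
  proof -
    have "mult m z a b = 0" for a b using that mult_nonzeroD(1)[OF m, of z a b] by blast
    then show "(\<Sum>a\<in>A. mult m z a x * i a unit_summand) = 0"
      "(\<Sum>a\<in>A. mult m z x a * i a unit_summand) = 0" by simp_all
  qed
  have "mat_comp m (mat_tensor S m (mat_diag (\<lambda>x. 1) A)) z s =
      mat_comp m (mat_comp (mat_tensor S (mat_diag (\<lambda>x. 1) A) m) (mat_assoc S A A A)) z s" for z s
  proof (cases "\<exists>x y e t. s = Fuse (Fuse x y e) t (label z) \<and> t \<in> A \<and> label z \<in> simples S \<and> fuses S e (label t) (label z)")
    case False
    then show ?thesis unfolding comp_tensor_left[OF m A(1)] comp_tensor_right[OF m A]
      by (auto split: summand.splits simp: Fuse_mem_sum_tensor)
  next
    case True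
    then obtain x y e t where s: "s = Fuse (Fuse x y e) t (label z)" "t \<in> A"
      "label z \<in> simples S" "fuses S e (label t) (label z)" by blast
    show ?thesis
    proof (cases "z \<in> A \<and> Fuse x y e \<in> sum_tensor S A A")
      case True
      then show ?thesis using s assoc[of x y t z e]
        by (auto simp: comp_tensor_left[OF m A(1)] comp_tensor_right[OF m A] Fuse_mem_sum_tensor)
    next
      case False
      have "mult m z e' t * mult m e' x y = 0" if "label e' = e" for e'
        using mult_nonzeroD[OF m, of z e' t] mult_nonzeroD[OF m, of e' x y] False that 
        by (auto simp: Fuse_mem_sum_tensor)
      then have "(\<Sum>e' | e' \<in> A \<and> label e' = e. mult m z e' t * mult m e' x y) = 0"
        by (auto intro!: sum.neutral)
      moreover have "(\<Sum>f\<in>A. assoc_coeff S (label x) (label y) (label t) (label z) (label f) e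
                  * (mult m z x f * mult m f y t)) = 0" if "Fuse x y e \<in> sum_tensor S A A"
      proof -
        have "mult m z x f = 0" for f using mult_nonzeroD(1)[OF m, of z x f] False that by blast
        then show ?thesis by simp
      qed
      ultimately show ?thesis
        by (auto simp: s comp_tensor_left[OF m A(1)] comp_tensor_right[OF m A] Fuse_mem_sum_tensor)
    qed
  qed
  moreover have "mat_comp m (mat_tensor S i (mat_diag (\<lambda>x. 1) A)) z s = mat_lunit S A z s" for z s
    using un un0 by (cases "z \<in> A") (auto simp: comp_unit_left[OF m i A] mat_lunit_def split: summand.splits)
  moreover have "mat_comp m (mat_tensor S (mat_diag (\<lambda>x. 1) A) i) z s = mat_runit S A z s" for z s
    using un un0 by (cases "z \<in> A") (auto simp: comp_unit_right[OF m i A] mat_runit_def split: summand.splits)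
  ultimately show "is_algebra C A m i"
    using A m i unfolding is_algebra_def by (simp add: fun_eq_iff)
qed

lemma commutative_coords:
  assumes comm: "commutative_algebra C A m" and m: "m \<in> mat_hom (sum_tensor S A A) A"
  shows "mult m z x y = mult m z y x * braid_coeff S (label x) (label y) (label z)"
proof (cases "Fuse x y (label z) \<in> sum_tensor S A A")
  case False
  then have "mult m z x y = 0 \<and> mult m z y x = 0"
    using mult_nonzeroD[OF m, of z] fuses_commute by (metis Fuse_mem_sum_tensor)
  then show ?thesis by simp
next
  case True
  let ?s = "Fuse x y (label z)" and ?t = "Fuse y x (label z)"
  have True': "?t \<in> sum_tensor S A A" using True fuses_commute by (auto simp: Fuse_mem_sum_tensor)
  have "mult m z x y = mat_comp m (mat_braid S A A) z ?s"
    using comm by (simp add: commutative_algebra_def mult_def)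
  also have "\<dots> = m z ?t * mat_braid S A A ?t ?s"
    by (rule mat_comp_single) (auto simp: mat_braid_def split: summand.splits if_splits)
  also have "\<dots> = mult m z y x * braid_coeff S (label x) (label y) (label z)"
    using True True' by (simp add: mat_braid_def mult_def)
  finally show ?thesis .
qed

end

section \<open>Simple algebras have no zero divisors of unit degree\<close>

text \<open>Coordinates for the image of a matrix: \<open>K\<close> is a maximal independent set of
  columns and \<open>p\<close> expresses every column through them. Taking columns as the basis
  keeps the image indexed by a subset of \<open>A\<close>, hence by the summands of an
  object.\<close>

lemma column_basis:
  fixes L :: "'b \<Rightarrow> 'a \<Rightarrow> 'k::field"
  assumes "finite A"
  obtains K p where "K \<subseteq> A" "\<And>x z. x \<in> A \<Longrightarrow> L z x = (\<Sum>y\<in>K. L z y * p y x)"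
    "\<And>d x. \<lbrakk>\<And>z. (\<Sum>y\<in>K. L z y * d y) = 0; x \<in> K\<rbrakk> \<Longrightarrow> d x = 0"
proof -
  define ind where "ind K \<longleftrightarrow> (\<forall>d. (\<forall>z. (\<Sum>y\<in>K. L z y * d y) = 0) \<longrightarrow> (\<forall>x\<in>K. d x = 0))" for K
  have "finite {K. K \<subseteq> A \<and> ind K}" "{} \<in> {K. K \<subseteq> A \<and> ind K}"
    using assms by (auto simp: ind_def)
  from finite_has_maximal2[OF this] obtain K where "K \<in> {K. K \<subseteq> A \<and> ind K}"
    and max0: "\<forall>K'\<in>{K. K \<subseteq> A \<and> ind K}. K \<subseteq> K' \<longrightarrow> K = K'" by auto
  then have K: "K \<subseteq> A" "ind K" by auto
  have max: "K = K'" if "K' \<subseteq> A" "ind K'" "K \<subseteq> K'" for K' using max0 that by blast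
  have finK: "finite K" using K assms finite_subset by blast
  have "\<exists>q. \<forall>z. L z x = (\<Sum>y\<in>K. L z y * q y)" if x: "x \<in> A" for x
  proof (cases "x \<in> K")
    case True
    have "(\<Sum>y\<in>K. L z y * (if y = x then 1 else 0)) = L z x" for z
      using True finK by (simp add: if_distrib[of "\<lambda>q. _ * q"] cong: if_cong)
    then show ?thesis by (intro exI[of _ "\<lambda>y. if y = x then 1 else 0"]) simp
  next
    case False
    then have "\<not> ind (insert x K)" using max[of "insert x K"] K x by blast
    then obtain d where d: "\<And>z. (\<Sum>y\<in>insert x K. L z y * d y) = 0" and nz: "\<exists>y\<in>insert x K. d y \<noteq> 0"
      unfolding ind_def by blast
    have sum0: "L z x * d x + (\<Sum>y\<in>K. L z y * d y) = 0" for z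
      using d[of z] False finK by simp
    have dx: "d x \<noteq> 0"
    proof
      assume "d x = 0"
      then have "\<forall>y\<in>K. d y = 0" using sum0 K(2) by (simp add: ind_def)
      with nz \<open>d x = 0\<close> show False by auto
    qed
    have "L z x = (\<Sum>y\<in>K. L z y * (- d y / d x))" for z
    proof -
      have "(\<Sum>y\<in>K. L z y * (- d y / d x)) = - (\<Sum>y\<in>K. L z y * d y) / d x"
        by (simp add: sum_negf[symmetric] sum_divide_distrib)
      also have "\<dots> = L z x" using sum0[of z] dx
        by (metis add_eq_0_iff2 nonzero_mult_div_cancel_right)
      finally show ?thesis ..
    qed
    then show ?thesis by (intro exI[of _ "\<lambda>y. - d y / d x"] allI)
  qed
  then have "\<forall>x\<in>A. \<exists>q. \<forall>z. L z x = (\<Sum>y\<in>K. L z y * q y)" by blast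
  from bchoice[OF this] obtain p where "\<And>x z. x \<in> A \<Longrightarrow> L z x = (\<Sum>y\<in>K. L z y * p x y)" by blast
  then show ?thesis using that[of K "\<lambda>y x. p x y"] K by (auto simp: ind_def)
qed

section \<open>Multiplication by elements of the unit component and its kernel\<close>

context involutive_fusion
begin

context
  fixes A m i
  assumes alg: "algebra_coords A m i"
begin

lemma algebra_A: "finite A" "label ` A \<subseteq> simples S"
  and algebra_mult: "m \<in> mat_hom (sum_tensor S A A) A"
  and algebra_unit: "i \<in> mat_hom {unit_summand} A"
  using alg by (auto simp: algebra_coords_def)

lemma algebra_label: "x \<in> A \<Longrightarrow> label x \<in> simples S"
  using algebra_A by auto

lemma algebra_assoc:
  assumes "x \<in> A" "y \<in> A" "t \<in> A" "z \<in> A" "e \<in> simples S"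
      "fuses S (label x) (label y) e" "fuses S e (label t) (label z)"
  shows "(\<Sum>e' | e' \<in> A \<and> label e' = e. mult m z e' t * mult m e' x y) =
        (\<Sum>f\<in>A. assoc_coeff S (label x) (label y) (label t) (label z) (label f) e
                  * (mult m z x f * mult m f y t))"
  using alg assms unfolding algebra_coords_def by blast

lemma algebra_unit_left:
  "\<lbrakk>x \<in> A; z \<in> A\<rbrakk> \<Longrightarrow> (\<Sum>a\<in>A. mult m z a x * i a unit_summand) = (if z = x then 1 else 0)"
  and algebra_unit_right:
  "\<lbrakk>x \<in> A; z \<in> A\<rbrakk> \<Longrightarrow> (\<Sum>a\<in>A. mult m z x a * i a unit_summand) = (if z = x then 1 else 0)"
  using alg by (auto simp: algebra_coords_def)

lemmas algebra_mult_nonzeroD = mult_nonzeroD[OF algebra_mult]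

text \<open>A unit label in the first place forces the intermediate label to be that of
  \<open>x\<close> and makes the associator trivial, so (ax)y = a(xy) holds without weights.\<close>

lemma mult_unit_degree_assoc:
  assumes a: "label a = unit_simple S"
  shows "(\<Sum>e\<in>A. mult m z e y * mult m e a x) = (\<Sum>f\<in>A. mult m z a f * mult m f x y)"
proof (cases "a \<in> A \<and> x \<in> A \<and> y \<in> A \<and> z \<in> A \<and> fuses S (label x) (label y) (label z)")
  case True
  have lab: "label e = label x" if "mult m e a x \<noteq> 0" for e
    using algebra_mult_nonzeroD[OF that] a fuses_unit_left algebra_label by auto
  have "(\<Sum>e\<in>A. mult m z e y * mult m e a x) =
      (\<Sum>e | e \<in> A \<and> label e = label x. mult m z e y * mult m e a x)"
    using algebra_A lab by (intro sum.mono_neutral_right) auto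
  also have "\<dots> = (\<Sum>f\<in>A. assoc_coeff S (label a) (label x) (label y) (label z) (label f) (label x)
                  * (mult m z a f * mult m f x y))"
    using True a algebra_label fuses_unit_left by (intro algebra_assoc) auto
  finally show ?thesis by (simp add: a assoc_unit_left)
next
  case False
  have 1: "mult m z e y * mult m e a x = 0" for e
  proof (rule ccontr)
    assume "\<not> ?thesis"
    then have nz: "mult m z e y \<noteq> 0" "mult m e a x \<noteq> 0" by auto
    then have "label e = label x"
      using algebra_mult_nonzeroD[OF nz(2)] a fuses_unit_left algebra_label by auto
    then show False using algebra_mult_nonzeroD[OF nz(1)] algebra_mult_nonzeroD[OF nz(2)] False by auto
  qed
  have 2: "mult m z a f * mult m f x y = 0" for f
  proof (rule ccontr)
    assume "\<not> ?thesis"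
    then have nz: "mult m z a f \<noteq> 0" "mult m f x y \<noteq> 0" by auto
    then have "label z = label f"
      using algebra_mult_nonzeroD[OF nz(1)] a fuses_unit_left algebra_label by auto
    then show False using algebra_mult_nonzeroD[OF nz(1)] algebra_mult_nonzeroD[OF nz(2)] False by auto
  qed
  show ?thesis by (simp only: 1 2)
qed

definition left_mult :: "('l summand \<Rightarrow> 'k) \<Rightarrow> 'l summand \<Rightarrow> 'l summand \<Rightarrow> 'k" where
  "left_mult c z x = (\<Sum>a\<in>A. c a * mult m z a x)"

text \<open>Coefficient vectors of elements of V_I; \<open>left_mult c\<close> is then a
  label-preserving operator on \<open>A\<close>.\<close>

definition unit_degree :: "('l summand \<Rightarrow> 'k) \<Rightarrow> bool" where
  "unit_degree c \<longleftrightarrow> (\<forall>a. c a \<noteq> 0 \<longrightarrow> a \<in> A \<and> label a = unit_simple S)"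

lemma left_mult_nonzeroD:
  assumes "unit_degree c" "left_mult c z x \<noteq> 0"
  shows "z \<in> A" "x \<in> A" "label z = label x"
proof -
  obtain a where a: "a \<in> A" "c a * mult m z a x \<noteq> 0"
    using assms(2) unfolding left_mult_def by (meson sum.not_neutral_contains_not_neutral)
  then have nz: "c a \<noteq> 0" "mult m z a x \<noteq> 0" by auto
  then have "label a = unit_simple S" using assms(1) by (auto simp: unit_degree_def)
  then show "z \<in> A" "x \<in> A" "label z = label x"
    using algebra_mult_nonzeroD[OF nz(2)] fuses_unit_left algebra_label by auto
qed

lemma left_mult_mult:
  assumes c: "unit_degree c"
  shows "(\<Sum>e\<in>A. left_mult c z e * mult m e x y) = (\<Sum>e\<in>A. mult m z e y * left_mult c e x)"
proof -
  have "(\<Sum>e\<in>A. left_mult c z e * mult m e x y) = (\<Sum>a\<in>A. c a * (\<Sum>f\<in>A. mult m z a f * mult m f x y))"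
    unfolding left_mult_def sum_distrib_right sum_distrib_left
    by (subst sum.swap) (simp add: mult.assoc)
  also have "\<dots> = (\<Sum>a\<in>A. c a * (\<Sum>e\<in>A. mult m z e y * mult m e a x))"
  proof (rule sum.cong[OF refl])
    fix a
    show "c a * (\<Sum>f\<in>A. mult m z a f * mult m f x y) = c a * (\<Sum>e\<in>A. mult m z e y * mult m e a x)"
      using mult_unit_degree_assoc[of a z y x] c by (cases "c a = 0") (auto simp: unit_degree_def)
  qed
  also have "\<dots> = (\<Sum>e\<in>A. mult m z e y * left_mult c e x)"
    unfolding left_mult_def sum_distrib_right sum_distrib_left
    by (subst sum.swap) (simp add: mult_ac)
  finally show ?thesis .
qed

lemma left_mult_unit:
  assumes c: "unit_degree c" and z: "z \<in> A"
  shows "(\<Sum>x\<in>A. left_mult c z x * i x unit_summand) = c z"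
proof -
  have "(\<Sum>x\<in>A. left_mult c z x * i x unit_summand) =
      (\<Sum>a\<in>A. c a * (\<Sum>x\<in>A. mult m z a x * i x unit_summand))"
    unfolding left_mult_def sum_distrib_right sum_distrib_left
    by (subst sum.swap) (simp add: mult.assoc)
  also have "\<dots> = (\<Sum>a\<in>A. if a = z then c a else 0)"
    by (rule sum.cong) (auto simp: algebra_unit_right z)
  finally show ?thesis using z algebra_A by simp
qed

context
  assumes comm: "commutative_algebra C A m"
begin

text \<open>Here commutativity turns c(yx) = (cy)x into c(xy) = x(cy). The two braidings cancel
  because their coefficient depends only on labels, which multiplication by \<open>c\<close>
  preserves.\<close>

lemma mult_left_mult:
  assumes c: "unit_degree c"
  shows "(\<Sum>e\<in>A. left_mult c z e * mult m e x y) = (\<Sum>e\<in>A. mult m z x e * left_mult c e y)"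
proof -
  note R = commutative_coords[OF comm algebra_mult]
  have "(\<Sum>e\<in>A. mult m z x e * left_mult c e y) =
      (\<Sum>e\<in>A. mult m z e x * left_mult c e y * braid_coeff S (label x) (label y) (label z))"
  proof (rule sum.cong[OF refl])
    fix e
    show "mult m z x e * left_mult c e y =
        mult m z e x * left_mult c e y * braid_coeff S (label x) (label y) (label z)"
      using left_mult_nonzeroD(3)[OF c, of e y] R[of z x e] by (cases "left_mult c e y = 0") auto
  qed
  also have "\<dots> = (\<Sum>e\<in>A. left_mult c z e * mult m e y x * braid_coeff S (label x) (label y) (label z))"
    by (simp only: sum_distrib_right[symmetric] left_mult_mult[OF c])
  also have "\<dots> = (\<Sum>e\<in>A. left_mult c z e * mult m e x y)"
  proof (rule sum.cong[OF refl])
    fix e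
    show "left_mult c z e * mult m e y x * braid_coeff S (label x) (label y) (label z) =
        left_mult c z e * mult m e x y"
      using left_mult_nonzeroD(3)[OF c, of z e] R[of e x y] by (cases "left_mult c z e = 0") auto
  qed
  finally show ?thesis ..
qed

text \<open>The kernel of multiplication by \<open>c\<close> is an ideal.  The matrix \<open>p\<close> below is the quotient map
  by this ideal, onto the span of a maximal set of independent columns.\<close>

lemma simple_left_mult_injective:
  assumes simple: "simple_algebra C A m i"
    and c: "unit_degree c" "c a0 \<noteq> 0"
    and v: "\<And>x. v x \<noteq> 0 \<Longrightarrow> x \<in> A \<and> label x = T"
    and ker: "\<And>z. (\<Sum>x\<in>A. left_mult c z x * v x) = 0"
  shows "v x0 = 0"
proof (rule ccontr)
  assume vx0: "v x0 \<noteq> 0"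
  then have T: "T \<in> simples S" using v algebra_label by blast
  note finA = algebra_A(1)
  let ?L = "left_mult c"
  obtain K q where K: "K \<subseteq> A" and q: "\<And>x z. x \<in> A \<Longrightarrow> ?L z x = (\<Sum>y\<in>K. ?L z y * q y x)"
    and ind: "\<And>d x. \<lbrakk>\<And>z. (\<Sum>y\<in>K. ?L z y * d y) = 0; x \<in> K\<rbrakk> \<Longrightarrow> d x = 0"
    by (rule column_basis[OF finA, of ?L]) blast
  have finK: "finite K" using K finA finite_subset by blast
  \<comment> \<open>Cutting off entries between different labels makes \<open>p\<close> a morphism
    by construction. As \<open>?L\<close> preserves labels, it still factors through
    \<open>p\<close>, which is \<open>Lp\<close>.\<close>
  define p where "p y x = (if y \<in> K \<and> x \<in> A \<and> label y = label x then q y x else 0)" for y x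
  have p_nz: "y \<in> K" "x \<in> A" "label y = label x" if "p y x \<noteq> 0" for x y
    using that by (auto simp: p_def split: if_splits)
  have Lp: "(\<Sum>y\<in>K. ?L z y * p y x) = ?L z x" if x: "x \<in> A" for x z
  proof (cases "label z = label x")
    case True
    have "(\<Sum>y\<in>K. ?L z y * p y x) = (\<Sum>y\<in>K. ?L z y * q y x)"
    proof (rule sum.cong[OF refl])
      fix y assume "y \<in> K"
      then show "?L z y * p y x = ?L z y * q y x"
        using left_mult_nonzeroD(3)[OF c(1), of z y] x True by (cases "?L z y = 0") (auto simp: p_def)
    qed
    then show ?thesis using q[OF x] by simp
  next
    case False
    then have "?L z y * p y x = 0" for y
      using left_mult_nonzeroD(3)[OF c(1), of z y] p_nz[of y x]
      by (cases "?L z y = 0"; cases "p y x = 0") auto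
    then have "(\<Sum>y\<in>K. ?L z y * p y x) = 0" by (intro sum.neutral) blast
    moreover have "?L z x = 0" using left_mult_nonzeroD(3)[OF c(1), of z x] False by auto
    ultimately show ?thesis by simp
  qed
  \<comment> \<open>Whatever \<open>?L\<close> kills is killed by \<open>p\<close>, since the
    columns in \<open>K\<close> are independent.\<close>
  have pker: "(\<Sum>x\<in>A. p y x * d x) = 0" if d: "\<And>z. (\<Sum>x\<in>A. ?L z x * d x) = 0" for d y
  proof (cases "y \<in> K")
    case True
    have "(\<Sum>y\<in>K. ?L z y * (\<Sum>x\<in>A. p y x * d x)) = 0" for z
    proof -
      have "(\<Sum>y\<in>K. ?L z y * (\<Sum>x\<in>A. p y x * d x)) = (\<Sum>x\<in>A. (\<Sum>y\<in>K. ?L z y * p y x) * d x)"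
        unfolding sum_distrib_right sum_distrib_left by (subst sum.swap) (simp add: mult.assoc)
      then show ?thesis using Lp d by simp
    qed
    from ind[OF this True] show ?thesis .
  next
    case False
    then show ?thesis by (simp add: p_def)
  qed
  \<comment> \<open>So the summands in \<open>K\<close> serve as representatives of the quotient
    classes.\<close>
  have pK: "p y x = (if y = x then 1 else 0)" if "y \<in> K" "x \<in> K" for x y
  proof -
    have "(\<Sum>y\<in>K. ?L z y * (p y x - (if y = x then 1 else 0))) = 0" for z
    proof -
      have "(\<Sum>y\<in>K. ?L z y * (if y = x then 1 else 0)) = ?L z x"
        using that finK by (simp add: if_distrib[of "\<lambda>q. _ * q"] cong: if_cong)
      then show ?thesis using Lp[of x z] that K by (auto simp: right_diff_distrib sum_subtractf)
    qed
    from ind[OF this that(1)] show ?thesis by simp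
  qed
  \<comment> \<open>The product in \<open>A\<close> followed by the projection. \<open>NL\<close>
    and \<open>NR\<close> below say that replacing a factor by its representative does not change
    it: the difference of the two products lies in the kernel of \<open>?L\<close>, by
    \<open>left_mult_mult\<close> and \<open>mult_left_mult\<close> respectively.\<close>
  define N where "N z x y = (\<Sum>z'\<in>A. p z z' * mult m z' x y)" for z x y
  have N_nz: "z \<in> K" "x \<in> A" "y \<in> A" "label z \<in> simples S" "fuses S (label x) (label y) (label z)"
    if nz: "N z x y \<noteq> 0" for x y z
  proof -
    obtain z' where "p z z' * mult m z' x y \<noteq> 0"
      using nz unfolding N_def by (meson sum.not_neutral_contains_not_neutral)
    then have "p z z' \<noteq> 0" "mult m z' x y \<noteq> 0" by auto
    from p_nz[OF this(1)] algebra_mult_nonzeroD[OF this(2)]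
    show "z \<in> K" "x \<in> A" "y \<in> A" "label z \<in> simples S" "fuses S (label x) (label y) (label z)"
      by auto
  qed
  have NL: "(\<Sum>e\<in>K. N z e t * p e x) = N z x t" if x: "x \<in> A" for x z t
  proof -
    let ?d = "\<lambda>w. mult m w x t - (\<Sum>e\<in>K. mult m w e t * p e x)"
    have "(\<Sum>w\<in>A. ?L y w * ?d w) = 0" for y
    proof -
      have "(\<Sum>w\<in>A. ?L y w * (\<Sum>e\<in>K. mult m w e t * p e x)) =
          (\<Sum>e\<in>K. (\<Sum>w\<in>A. ?L y w * mult m w e t) * p e x)"
        unfolding sum_distrib_right sum_distrib_left by (subst sum.swap) (simp add: mult.assoc)
      also have "\<dots> = (\<Sum>w\<in>A. mult m y w t * (\<Sum>e\<in>K. ?L w e * p e x))"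
        unfolding left_mult_mult[OF c(1)] sum_distrib_right sum_distrib_left
        by (subst sum.swap) (simp add: mult.assoc)
      also have "\<dots> = (\<Sum>w\<in>A. ?L y w * mult m w x t)"
        by (simp add: Lp[OF x] left_mult_mult[OF c(1)])
      finally show ?thesis by (simp add: right_diff_distrib sum_subtractf)
    qed
    from pker[OF this, of z] have "(\<Sum>w\<in>A. p z w * (\<Sum>e\<in>K. mult m w e t * p e x)) = N z x t"
      by (simp add: right_diff_distrib sum_subtractf N_def)
    moreover have "(\<Sum>w\<in>A. p z w * (\<Sum>e\<in>K. mult m w e t * p e x)) = (\<Sum>e\<in>K. N z e t * p e x)"
      unfolding N_def sum_distrib_right sum_distrib_left by (subst sum.swap) (simp add: mult.assoc)
    ultimately show ?thesis by simp
  qed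
  have NR: "(\<Sum>e\<in>K. N z t e * p e x) = N z t x" if x: "x \<in> A" for x z t
  proof -
    let ?d = "\<lambda>w. mult m w t x - (\<Sum>e\<in>K. mult m w t e * p e x)"
    have "(\<Sum>w\<in>A. ?L y w * ?d w) = 0" for y
    proof -
      have "(\<Sum>w\<in>A. ?L y w * (\<Sum>e\<in>K. mult m w t e * p e x)) =
          (\<Sum>e\<in>K. (\<Sum>w\<in>A. ?L y w * mult m w t e) * p e x)"
        unfolding sum_distrib_right sum_distrib_left by (subst sum.swap) (simp add: mult.assoc)
      also have "\<dots> = (\<Sum>w\<in>A. mult m y t w * (\<Sum>e\<in>K. ?L w e * p e x))"
        unfolding mult_left_mult[OF c(1)] sum_distrib_right sum_distrib_left
        by (subst sum.swap) (simp add: mult.assoc)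
      also have "\<dots> = (\<Sum>w\<in>A. ?L y w * mult m w t x)"
        by (simp add: Lp[OF x] mult_left_mult[OF c(1)])
      finally show ?thesis by (simp add: right_diff_distrib sum_subtractf)
    qed
    from pker[OF this, of z] have "(\<Sum>w\<in>A. p z w * (\<Sum>e\<in>K. mult m w t e * p e x)) = N z t x"
      by (simp add: right_diff_distrib sum_subtractf N_def)
    moreover have "(\<Sum>w\<in>A. p z w * (\<Sum>e\<in>K. mult m w t e * p e x)) = (\<Sum>e\<in>K. N z t e * p e x)"
      unfolding N_def sum_distrib_right sum_distrib_left by (subst sum.swap) (simp add: mult.assoc)
    ultimately show ?thesis by simp
  qed
  define m' where "m' z s = (case s of Fuse x y d \<Rightarrow> if x \<in> K \<and> y \<in> K \<and> d = label z then N z x y else 0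
    | _ \<Rightarrow> 0)" for z s
  define i' where "i' z s = (if s = unit_summand then \<Sum>a\<in>A. p z a * i a unit_summand else 0)" for z s
  have m'N: "mult m' z x y = N z x y" if "x \<in> K" "y \<in> K" for x y z
    using that by (simp add: mult_def m'_def)
  have m': "m' \<in> mat_hom (sum_tensor S K K) K"
    using N_nz by (intro mat_homI) (auto simp: m'_def Fuse_mem_sum_tensor split: summand.splits if_splits)
  have i': "i' \<in> mat_hom {unit_summand} K"
  proof (rule mat_homI)
    fix z s assume nz: "i' z s \<noteq> 0"
    then have s: "s = unit_summand" by (auto simp: i'_def split: if_splits)
    then obtain a where "p z a * i a unit_summand \<noteq> 0"
      using nz unfolding i'_def by (metis (no_types, lifting) sum.neutral)
    then have "p z a \<noteq> 0" "i a unit_summand \<noteq> 0" by auto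
    then show "z \<in> K \<and> s \<in> {unit_summand} \<and> label z = label s"
      using p_nz[of z a] mat_homD(3)[OF algebra_unit, of a] s by auto
  qed
  have p: "p \<in> mat_hom A K" using p_nz by (intro mat_homI) auto
  have "algebra_coords K m' i'"
  proof -
    have "(\<Sum>e' | e' \<in> K \<and> label e' = e. mult m' z e' t * mult m' e' x y) =
        (\<Sum>f\<in>K. assoc_coeff S (label x) (label y) (label t) (label z) (label f) e
                  * (mult m' z x f * mult m' f y t))"
      if mem: "x \<in> K" "y \<in> K" "t \<in> K" "z \<in> K" "e \<in> simples S"
      and f: "fuses S (label x) (label y) e" "fuses S e (label t) (label z)" for x y t z e
    proof -
      let ?F = "\<lambda>f. assoc_coeff S (label x) (label y) (label t) (label z) f e"
      have "(\<Sum>e' | e' \<in> K \<and> label e' = e. mult m' z e' t * mult m' e' x y) =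
          (\<Sum>e'\<in>K. \<Sum>a | a \<in> A \<and> label a = e. N z e' t * (p e' a * mult m a x y))"
      proof -
        \<comment> \<open>As \<open>p\<close> preserves labels, restricting the representative
          \<open>e'\<close> to the label \<open>e\<close> is the same as restricting the summands
          \<open>a\<close> of the product in \<open>A\<close>.\<close>
        have "(\<Sum>a | a \<in> A \<and> label a = e. N z e' t * (p e' a * mult m a x y)) =
            (if label e' = e then N z e' t * N e' x y else 0)" for e'
        proof (cases "label e' = e")
          case True
          have "(\<Sum>a | a \<in> A \<and> label a = e. p e' a * mult m a x y) = N e' x y"
            unfolding N_def by (rule sum.mono_neutral_left) (use finA p_nz True in auto)
          then show ?thesis using True by (simp add: sum_distrib_left[symmetric])
        next
          case False
          then have "p e' a = 0" if "label a = e" for a using that p_nz(3)[of e' a] by auto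
          then show ?thesis using False by (auto intro!: sum.neutral)
        qed
        then have "(\<Sum>e'\<in>K. \<Sum>a | a \<in> A \<and> label a = e. N z e' t * (p e' a * mult m a x y)) =
            (\<Sum>e'\<in>K. if label e' = e then N z e' t * N e' x y else 0)" by simp
        also have "\<dots> = (\<Sum>e' | e' \<in> K \<and> label e' = e. N z e' t * N e' x y)"
          using finK by (intro sum.inter_filter[symmetric])
        also have "\<dots> = (\<Sum>e' | e' \<in> K \<and> label e' = e. mult m' z e' t * mult m' e' x y)"
          using mem by (intro sum.cong) (auto simp: m'N)
        finally show ?thesis ..
      qed
      also have "\<dots> = (\<Sum>a | a \<in> A \<and> label a = e. (\<Sum>e'\<in>K. N z e' t * p e' a) * mult m a x y)"
        unfolding sum_distrib_right by (subst sum.swap) (simp add: mult.assoc)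
      also have "\<dots> = (\<Sum>a | a \<in> A \<and> label a = e. N z a t * mult m a x y)"
        by (rule sum.cong) (auto simp: NL)
      also have "\<dots> = (\<Sum>w\<in>A. p z w * (\<Sum>a | a \<in> A \<and> label a = e. mult m w a t * mult m a x y))"
        unfolding N_def sum_distrib_right sum_distrib_left by (subst sum.swap) (simp add: mult.assoc)
      \<comment> \<open>Associativity of \<open>A\<close> is invoked only at those \<open>w\<close>
        that \<open>p z w\<close> detects; these share the label of \<open>z\<close>.\<close>
      also have "\<dots> = (\<Sum>w\<in>A. p z w * (\<Sum>f\<in>A. ?F (label f) * (mult m w x f * mult m f y t)))"
      proof (rule sum.cong[OF refl])
        fix w assume w: "w \<in> A"
        show "p z w * (\<Sum>a | a \<in> A \<and> label a = e. mult m w a t * mult m a x y) =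
            p z w * (\<Sum>f\<in>A. ?F (label f) * (mult m w x f * mult m f y t))"
          using algebra_assoc[of x y t w e] mem f w K p_nz(3)[of z w] by (cases "p z w = 0") auto
      qed
      also have "\<dots> = (\<Sum>f\<in>A. ?F (label f) * (N z x f * mult m f y t))"
        unfolding N_def sum_distrib_right sum_distrib_left by (subst sum.swap) (simp add: mult_ac)
      also have "\<dots> = (\<Sum>f\<in>A. \<Sum>e'\<in>K. ?F (label e') * (N z x e' * (p e' f * mult m f y t)))"
      proof (rule sum.cong[OF refl])
        fix f assume "f \<in> A"
        then have "?F (label f) * (N z x f * mult m f y t) =
            (\<Sum>e'\<in>K. ?F (label f) * (N z x e' * (p e' f * mult m f y t)))"
          unfolding NR[symmetric, OF \<open>f \<in> A\<close>] by (simp add: sum_distrib_right sum_distrib_left mult_ac)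
        \<comment> \<open>The associator depends on \<open>f\<close> only through its label, so its
          weight can be moved to the representative \<open>e'\<close>.\<close>
        also have "\<dots> = (\<Sum>e'\<in>K. ?F (label e') * (N z x e' * (p e' f * mult m f y t)))"
        proof (rule sum.cong[OF refl])
          fix e'
          show "?F (label f) * (N z x e' * (p e' f * mult m f y t)) =
              ?F (label e') * (N z x e' * (p e' f * mult m f y t))"
            using p_nz(3)[of e' f] by (cases "p e' f = 0") auto
        qed
        finally show "?F (label f) * (N z x f * mult m f y t) =
            (\<Sum>e'\<in>K. ?F (label e') * (N z x e' * (p e' f * mult m f y t)))" .
      qed
      also have "\<dots> = (\<Sum>e'\<in>K. ?F (label e') * (N z x e' * N e' y t))"
        unfolding N_def[of _ y t] sum_distrib_left by (rule sum.swap)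
      also have "\<dots> = (\<Sum>f\<in>K. ?F (label f) * (mult m' z x f * mult m' f y t))"
        using mem by (intro sum.cong) (auto simp: m'N)
      finally show ?thesis .
    qed
    moreover have "(\<Sum>a\<in>K. mult m' z a x * i' a unit_summand) = (if z = x then 1 else 0)"
      "(\<Sum>a\<in>K. mult m' z x a * i' a unit_summand) = (if z = x then 1 else 0)" if "x \<in> K" "z \<in> K" for x z
    proof -
      have px: "(\<Sum>w\<in>A. p z w * (if w = x then 1 else 0)) = (if z = x then 1 else 0)"
        using that K finA pK by (auto simp: if_distrib[of "\<lambda>q. _ * q"] cong: if_cong)
      have "(\<Sum>a\<in>K. mult m' z a x * i' a unit_summand) = (\<Sum>b\<in>A. (\<Sum>a\<in>K. N z a x * p a b) * i b unit_summand)"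
        unfolding i'_def sum_distrib_right
        by (subst sum.swap) (use that in \<open>simp add: m'N sum_distrib_left mult.assoc\<close>)
      also have "\<dots> = (\<Sum>w\<in>A. p z w * (\<Sum>b\<in>A. mult m w b x * i b unit_summand))"
        by (simp add: NL) (unfold N_def sum_distrib_right sum_distrib_left, subst sum.swap, simp add: mult.assoc)
      also have "\<dots> = (\<Sum>w\<in>A. p z w * (if w = x then 1 else 0))"
        using that K by (intro sum.cong) (auto simp: algebra_unit_left)
      finally show "(\<Sum>a\<in>K. mult m' z a x * i' a unit_summand) = (if z = x then 1 else 0)" using px by simp
      have "(\<Sum>a\<in>K. mult m' z x a * i' a unit_summand) = (\<Sum>b\<in>A. (\<Sum>a\<in>K. N z x a * p a b) * i b unit_summand)"
        unfolding i'_def sum_distrib_right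
        by (subst sum.swap) (use that in \<open>simp add: m'N sum_distrib_left mult.assoc\<close>)
      also have "\<dots> = (\<Sum>w\<in>A. p z w * (\<Sum>b\<in>A. mult m w x b * i b unit_summand))"
        by (simp add: NR) (unfold N_def sum_distrib_right sum_distrib_left, subst sum.swap, simp add: mult.assoc)
      also have "\<dots> = (\<Sum>w\<in>A. p z w * (if w = x then 1 else 0))"
        using that K by (intro sum.cong) (auto simp: algebra_unit_right)
      finally show "(\<Sum>a\<in>K. mult m' z x a * i' a unit_summand) = (if z = x then 1 else 0)" using px by simp
    qed
    ultimately show ?thesis
      using finK image_mono[OF K, of label] algebra_A(2) m' i' unfolding algebra_coords_def
      by (auto simp: subset_iff)
  qed
  then have alg': "is_algebra C K m' i'" by (simp add: is_algebra_iff)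
  have "mat_comp p m z s = mat_comp m' (mat_tensor S p p) z s" for z s
  proof -
    have lhs: "mat_comp p m z s = (\<Sum>w\<in>A. p z w * m w s)"
      using finA mat_homD(1)[OF algebra_mult] by (intro mat_comp_sum)
    show ?thesis
    proof (cases "\<exists>x y. s = Fuse x y (label z) \<and> x \<in> A \<and> y \<in> A \<and> label z \<in> simples S
        \<and> fuses S (label x) (label y) (label z)")
      case False
      have 1: "p z w * m w s = 0" for w
      proof (rule ccontr)
        assume "\<not> ?thesis"
        then have nz: "p z w \<noteq> 0" "m w s \<noteq> 0" by auto
        then show False using False p_nz[OF nz(1)] mat_homD[OF algebra_mult nz(2)] 
          by (auto elim!: sum_tensorE)
      qed
      have 2: "m' z r * mat_tensor S p p r s = 0" for r
      proof (rule ccontr)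
        assume "\<not> ?thesis"
        then have nz: "m' z r \<noteq> 0" "mat_tensor S p p r s \<noteq> 0" by auto
        have "label z = label r" using mat_homD(3)[OF m' nz(1)] .
        with nz(2) False p_nz(2) show False by (auto elim!: mat_tensor_nonzeroE)
      qed
      show ?thesis
        using mat_comp_zero_products[of p z m s, OF 1]
          mat_comp_zero_products[of m' z "mat_tensor S p p" s, OF 2] by simp
    next
      case True
      then obtain x y where s: "s = Fuse x y (label z)" and mem: "x \<in> A" "y \<in> A" "label z \<in> simples S"
        "fuses S (label x) (label y) (label z)" by blast
      have "mat_comp m' (mat_tensor S p p) z s = (\<Sum>(a, b)\<in>K\<times>K.
          m' z (Fuse a b (label z)) * mat_tensor S p p (Fuse a b (label z)) s)"
        using mat_comp_reindex[of "K \<times> K" "\<lambda>(a, b). Fuse a b (label z)" "mat_tensor S p p" s m' z] p_nz(1)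
        by (auto simp: finK inj_on_def s image_iff case_prod_beta elim!: mat_tensor_nonzeroE)
      also have "\<dots> = (\<Sum>a\<in>K. \<Sum>b\<in>K. N z a b * p b y * p a x)"
        unfolding sum.cartesian_product
        by (rule sum.cong) (auto simp: m'_def s mat_tensor_Fuse mem)
      also have "\<dots> = N z x y"
        using mem by (simp add: sum_distrib_right[symmetric] NR NL)
      also have "\<dots> = mat_comp p m z s"
        unfolding lhs N_def
      proof (rule sum.cong[OF refl])
        fix w
        show "p z w * mult m w x y = p z w * m w s" 
          using p_nz(3)[of z w] by (cases "p z w = 0") (auto simp: mult_def s)
      qed
      finally show ?thesis ..
    qed
  qed
  moreover have "mat_comp p i z s = i' z s" for z s
  proof (cases "s = unit_summand")
    case True
    show ?thesis unfolding True
      using mat_comp_sum[of A i unit_summand p z] finA mat_homD(1)[OF algebra_unit] by (simp add: i'_def)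
  next
    case False
    then have "i r s = 0" for r using mat_homD(2)[OF algebra_unit, of r s] by auto
    then show ?thesis using False mat_comp_zero[of i s p z] by (simp add: i'_def)
  qed
  ultimately have hom: "algebra_hom C A m i K m' i' p"
    using p by (simp add: algebra_hom_def fun_eq_iff)
  \<comment> \<open>Applied to the unit, multiplication by \<open>c\<close> returns
    \<open>c\<close>, which is non-zero. Hence \<open>?L\<close> has a non-zero column and
    \<open>K\<close> is not empty.\<close>
  have "p \<noteq> (\<lambda>y x. 0)"
  proof -
    have "a0 \<in> A" using c by (auto simp: unit_degree_def)
    then have "(\<Sum>x\<in>A. ?L a0 x * i x unit_summand) \<noteq> 0" using left_mult_unit[OF c(1)] c(2) by simp
    then obtain x where "x \<in> A" "?L a0 x \<noteq> 0" by (metis (no_types, lifting) mult_zero_left sum.neutral)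
    then obtain y where "y \<in> K" using Lp[of x a0] by fastforce
    then have "p y y = 1" using pK by simp
    then show ?thesis by (metis zero_neq_one)
  qed
  then have monic: "monic C A K p"
    using simple alg' hom unfolding simple_algebra_def by auto
  \<comment> \<open>The vector \<open>v\<close> becomes a morphism out of a single copy of
    \<open>T\<close>, which is why it is taken homogeneous. It has the same composite with
    \<open>p\<close> as the zero morphism.\<close>
  let ?Z = "{Summand T 0}" and ?g = "\<lambda>x s. if s = Summand T 0 then v x else 0"
  have g: "?g \<in> mat_hom ?Z A" using v by (intro mat_homI) (auto split: if_splits)
  have "mat_comp p ?g z s = mat_comp p (\<lambda>y x. 0) z s" for z s
  proof -
    have "mat_comp p ?g z s = (\<Sum>x\<in>A. p z x * ?g x s)"
      using finA v by (intro mat_comp_sum) (auto split: if_splits)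
    also have "\<dots> = 0" using pker[OF ker] by (cases "s = Summand T 0") simp_all
    finally show ?thesis by (simp add: mat_comp_zero)
  qed
  then have eq: "mat_comp p ?g = mat_comp p (\<lambda>y x. 0)" by blast
  have Z: "?Z \<in> Obj C" using T by simp
  have g': "?g \<in> Hom C ?Z A" unfolding C_simps by (rule g)
  have h: "(\<lambda>y x. 0) \<in> Hom C ?Z A" unfolding C_simps by (simp add: mat_hom_def)
  have "\<forall>Z\<in>Obj C. \<forall>g\<in>Hom C Z A. \<forall>h\<in>Hom C Z A. mat_comp p g = mat_comp p h \<longrightarrow> g = h"
    using monic unfolding monic_def C_simps(4) by (rule conjunct2)
  from this[rule_format, OF Z g' h eq] have "?g = (\<lambda>y x. 0)" .
  from fun_cong[OF fun_cong[OF this, of x0], of "Summand T 0"] vx0 show False by simp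
qed

end
end
end

section \<open>The unit component\<close>

text \<open>Numbering the index set gives a square matrix whose characteristic polynomial has degree
  \<open>card Y > 0\<close>, hence a root in an algebraically closed field.\<close>

lemma eigenvector_exists:
  fixes L :: "'a \<Rightarrow> 'a \<Rightarrow> 'k::alg_closed_field"
  assumes fin: "finite Y" and ne: "Y \<noteq> {}"
  obtains k v where "\<exists>y\<in>Y. v y \<noteq> 0" "\<And>y. v y \<noteq> 0 \<Longrightarrow> y \<in> Y"
    "\<And>z. z \<in> Y \<Longrightarrow> (\<Sum>x\<in>Y. L z x * v x) = k * v z"
proof -
  obtain h where h: "bij_betw h {0..<card Y} Y" using ex_bij_betw_nat_finite[OF fin] by blast
  define n where "n = card Y"
  define M where "M = mat n n (\<lambda>(r, s). L (h r) (h s))"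
  have M: "M \<in> carrier_mat n n" by (simp add: M_def)
  have "degree (char_poly M) > 0" using degree_monic_char_poly[OF M] fin ne by (simp add: n_def card_gt_0_iff)
  then obtain k where "poly (char_poly M) k = 0" using alg_closed_imp_poly_has_root by blast
  then have "eigenvalue M k" using eigenvalue_root_char_poly[OF M] by simp
  then obtain w where w: "w \<in> carrier_vec n" "w \<noteq> 0\<^sub>v n" "M *\<^sub>v w = k \<cdot>\<^sub>v w"
    using M by (auto simp: eigenvalue_def eigenvector_def)
  define v where "v y = (if y \<in> Y then w $ inv_into {0..<n} h y else 0)" for y
  have vh: "v (h r) = w $ r" if "r < n" for r
    using that h bij_betw_inv_into_left[OF h, of r] by (auto simp: v_def n_def bij_betw_def)
  obtain r where r: "r < n" "w $ r \<noteq> 0" using w(1,2) by (metis carrier_vecD eq_vecI index_zero_vec)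
  show ?thesis
  proof (rule that)
    show "\<exists>y\<in>Y. v y \<noteq> 0" using vh[OF r(1)] r h by (intro bexI[of _ "h r"]) (auto simp: n_def bij_betw_def)
    show "y \<in> Y" if "v y \<noteq> 0" for y using that by (auto simp: v_def split: if_splits)
    fix z assume "z \<in> Y"
    then have "z \<in> h ` {0..<n}" using h by (simp add: bij_betw_def n_def)
    then obtain q where q: "q < n" "z = h q" by auto
    have "(\<Sum>x\<in>Y. L z x * v x) = (\<Sum>s\<in>{0..<n}. L z (h s) * v (h s))"
      using sum.reindex_bij_betw[OF h, of "\<lambda>x. L z x * v x"] by (simp add: n_def)
    also have "\<dots> = (M *\<^sub>v w) $ q"
      using q w(1) by (auto simp: M_def scalar_prod_def vh intro!: sum.cong)
    also have "\<dots> = k * v z" using q w vh by simp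
    finally show "(\<Sum>x\<in>Y. L z x * v x) = k * v z" .
  qed
qed

text \<open>Over an algebraically closed field, injectivity of all non-zero multiplications forces
  every element of V_I to be a multiple of the unit. The one remaining summand must carry a non-zero
  coefficient of the unit map.\<close>

lemma simple_algebra_connected:
  fixes S :: "('l, 'k::alg_closed_field) fusion_data"
  assumes "involutive_fusion S"
    and alg: "is_algebra (semisimple_category S) A m i"
    and comm: "commutative_algebra (semisimple_category S) A m"
    and simple: "simple_algebra (semisimple_category S) A m i"
  obtains a where "a \<in> A" "label a = unit_simple S" "i a (Summand (unit_simple S) 0) \<noteq> 0"
    "\<And>x. \<lbrakk>x \<in> A; label x = unit_simple S\<rbrakk> \<Longrightarrow> x = a"
proof -
  interpret involutive_fusion S by fact
  have coords: "algebra_coords A m i" using alg is_algebra_iff by blast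
  note finA = algebra_A(1)[OF coords]
  let ?L = "left_mult A m" and ?\<eta> = "\<lambda>x. i x unit_summand"
  let ?Y = "{x \<in> A. label x = unit_simple S}"
  have \<eta>: "unit_degree A ?\<eta>"
    using mat_homD(1,3)[OF algebra_unit[OF coords], of _ unit_summand]
    by (simp add: unit_degree_def[OF coords])
  have L\<eta>: "?L ?\<eta> z x = (if z = x then 1 else 0)" if "x \<in> A" "z \<in> A" for z x
    using algebra_unit_left[OF coords that] by (simp add: left_mult_def[OF coords] mult.commute)
  have A_ne: "A \<noteq> {}"
    using simple by (auto simp: simple_algebra_def mat_diag_def)
  then obtain x where x: "x \<in> A" by blast
  have "(\<Sum>a\<in>A. mult m x a x * ?\<eta> a) \<noteq> 0" using algebra_unit_left[OF coords x x] by simp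
  then obtain a where a: "a \<in> A" "mult m x a x * ?\<eta> a \<noteq> 0"
    by (rule sum.not_neutral_contains_not_neutral)
  from a(2) have a: "a \<in> A" "?\<eta> a \<noteq> 0" using a(1) by auto
  then have aY: "a \<in> ?Y" using \<eta> by (auto simp: unit_degree_def[OF coords])
  have finY: "finite ?Y" and neY: "?Y \<noteq> {}" using finA aY by auto
  have scalar: "\<exists>k. \<forall>b. c b = k * ?\<eta> b" if c: "unit_degree A c" for c
  proof -
    obtain k v where v: "\<exists>y\<in>?Y. v y \<noteq> 0" "\<And>y. v y \<noteq> 0 \<Longrightarrow> y \<in> ?Y"
      and eig: "\<And>z. z \<in> ?Y \<Longrightarrow> (\<Sum>x\<in>?Y. ?L c z x * v x) = k * v z"
      by (rule eigenvector_exists[OF finY neY, of "?L c"]) blast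
    \<comment> \<open>Subtracting the eigenvalue times the unit makes multiplication by
      \<open>c'\<close> kill the eigenvector \<open>v\<close>, so \<open>c'\<close> must be
      zero.\<close>
    define c' where "c' b = c b - k * ?\<eta> b" for b
    have c': "unit_degree A c'"
      unfolding unit_degree_def[OF coords]
    proof (intro allI impI)
      fix b assume "c' b \<noteq> 0"
      then have "c b \<noteq> 0 \<or> ?\<eta> b \<noteq> 0" by (auto simp: c'_def)
      then show "b \<in> A \<and> label b = unit_simple S"
        using c \<eta> by (auto simp: unit_degree_def[OF coords])
    qed
    have L': "?L c' z x = ?L c z x - k * ?L ?\<eta> z x" for z x
      by (simp add: left_mult_def[OF coords] c'_def left_diff_distrib sum_subtractf sum_distrib_left mult.assoc)
    have "(\<Sum>x\<in>A. ?L c' z x * v x) = 0" for z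
    proof (cases "z \<in> ?Y")
      case True
      have "(\<Sum>x\<in>A. ?L c' z x * v x) = (\<Sum>x\<in>?Y. ?L c' z x * v x)"
        using finA v(2) by (intro sum.mono_neutral_right) auto
      also have "\<dots> = (\<Sum>x\<in>?Y. ?L c z x * v x) - (\<Sum>x\<in>?Y. if x = z then k * v x else 0)"
        unfolding sum_subtractf[symmetric] using True
        by (intro sum.cong) (auto simp: L' L\<eta> left_diff_distrib)
      also have "\<dots> = 0" using eig[OF True] True finA by simp
      finally show ?thesis .
    next
      case False
      have "?L c' z x * v x = 0" for x
      proof (rule ccontr)
        assume "\<not> ?thesis"
        then have nz: "?L c' z x \<noteq> 0" "v x \<noteq> 0" by auto
        show False using left_mult_nonzeroD[OF coords c' nz(1)] v(2)[OF nz(2)] False by auto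
      qed
      then show ?thesis by (intro sum.neutral) blast
    qed
    then have "v y = 0" if "c' b \<noteq> 0" for b y
      using simple_left_mult_injective[OF coords comm simple c' that, of v "unit_simple S"] v(2) by blast
    then have "c' b = 0" for b using v(1) by blast
    then show ?thesis by (intro exI[of _ k]) (simp add: c'_def)
  qed
  \<comment> \<open>A second summand \<open>x\<close> would make its indicator vector a multiple of
    the unit: the entry at \<open>a\<close> forces the factor to be 0, the entry at \<open>x\<close>
    forbids it.\<close>
  have uniq: "x = a" if x: "x \<in> ?Y" for x
  proof (rule ccontr)
    assume "x \<noteq> a"
    have "unit_degree A (\<lambda>y. if y = x then 1 else 0)" using x by (auto simp: unit_degree_def[OF coords])
    from scalar[OF this] obtain k where k: "\<And>b. (if b = x then 1 else 0) = k * ?\<eta> b" by blast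
    from k[of x] k[of a] a(2) \<open>x \<noteq> a\<close> show False by auto
  qed
  show ?thesis using that[of a] a aY uniq by blast
qed

section \<open>Partners under the separability pairing; algebras with a single summand\<close>

context involutive_fusion
begin

text \<open>The non-degeneracy identity has entry 1 at (\<open>x\<close>, \<open>x\<close>), so a
  path of non-zero entries runs through the whole composite. The unit constraints fix its two ends,
  and the middle exhibits a partner \<open>y\<close> of \<open>x\<close>. The counit preserves
  labels, so the product reaches it through a summand \<open>w\<close> with the unit label.\<close>

lemma separable_pairing:
  assumes alg: "is_algebra C A m i" and sep: "separable_algebra C A m" and x: "x \<in> A"
  obtains y w where "w \<in> A" "y \<in> A" "label w = unit_simple S" "mult m w x y \<noteq> 0"
proof -
  have coords: "algebra_coords A m i" using alg is_algebra_iff by blast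
  note A = algebra_A[OF coords] and m = algebra_mult[OF coords]
  obtain D ev coev \<kappa> where D: "is_dual C A D ev coev" and
    \<kappa>: "mat_comp (mat_lunit S A) (mat_comp (mat_tensor S (mat_comp (algebra_counit C A m D ev coev) m) (mat_diag (\<lambda>x. 1) A))
      (mat_comp (AssocInv C A A A) (mat_comp (mat_tensor S (mat_diag (\<lambda>x. 1) A) \<kappa>) (RUnitInv C A)))) = mat_diag (\<lambda>x. 1) A"
    using sep unfolding separable_algebra_def nondegenerate_pairing_def by auto
  let ?\<epsilon> = "algebra_counit C A m D ev coev"
  have D': "finite D" "label ` D \<subseteq> simples S" and "graded ev"
    using D by (auto simp: is_dual_def intro: graded_hom)
  then have \<epsilon>: "graded ?\<epsilon>"
    unfolding algebra_counit_def
    unfolding RUnitInv_eq[OF A] AssocInv_eq[OF A A D']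
    unfolding C_simps
    by (intro graded_comp graded_braid graded_tensor graded_assoc_inv graded_runit_inv)
  note \<kappa>' = fun_cong[OF fun_cong[OF \<kappa>[unfolded RUnitInv_eq[OF A] AssocInv_eq[OF A A A]]], of x x]
  from \<kappa>' x have "mat_comp (mat_lunit S A) (mat_comp (mat_tensor S (mat_comp ?\<epsilon> m) (mat_diag (\<lambda>x. 1) A))
      (mat_comp (mat_assoc_inv A A A) (mat_comp (mat_tensor S (mat_diag (\<lambda>x. 1) A) \<kappa>)
        (\<lambda>s x. mat_runit S A x s)))) x x \<noteq> 0"
    by (simp add: mat_diag_def)
  then obtain s1 s2 s3 s4 where s1: "mat_lunit S A x s1 \<noteq> (0::'k)"
    and s2: "mat_tensor S (mat_comp ?\<epsilon> m) (mat_diag (\<lambda>x. 1) A) s1 s2 \<noteq> 0"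
    and s3: "mat_assoc_inv A A A s2 s3 \<noteq> 0"
    and s4: "mat_tensor S (mat_diag (\<lambda>x. 1) A) \<kappa> s3 s4 \<noteq> 0"
    and s5: "mat_runit S A x s4 \<noteq> (0::'k)"
    by (elim mat_comp_nonzeroE) blast
  have "s1 = Fuse unit_summand x (label x)" "s4 = Fuse x unit_summand (label x)"
    using s1 s5 by (auto simp: mat_lunit_def mat_runit_def split: if_splits)
  then obtain y e where "mat_comp ?\<epsilon> m unit_summand (Fuse x y e) \<noteq> 0"
    using s2 s3 s4
    by (auto elim!: mat_tensor_nonzeroE mat_assoc_inv_nonzeroE dest!: mat_diag_nonzeroD)
  then obtain w where w: "?\<epsilon> unit_summand w \<noteq> 0" "m w (Fuse x y e) \<noteq> 0"
    by (rule mat_comp_nonzeroE)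
  have "mult m w x y \<noteq> 0" using w mat_homD(3)[OF m w(2)] by (simp add: mult_def)
  moreover have "label w = unit_simple S" using \<epsilon> w(1) by (fastforce simp: graded_def)
  ultimately show ?thesis using that mult_nonzeroD[OF m] by blast
qed

text \<open>The unit map is itself the isomorphism, and \<open>f\<close> inverts its coefficient.
  The unit law forces the only structure constant to be \<open>1 / ?\<eta>\<close>, which makes
  \<open>f\<close> multiplicative.\<close>

lemma singleton_algebra_isomorphic_unit:
  assumes alg: "is_algebra C {a} m i"
    and a: "label a = unit_simple S" and \<eta>: "i a unit_summand \<noteq> 0"
  shows "isomorphic_algebras C {a} m i (Unit C) (LUnit C (Unit C)) (Id C (Unit C))"
proof -
  have coords: "algebra_coords {a} m i" using alg is_algebra_iff by blast
  note m = algebra_mult[OF coords] and i = algebra_unit[OF coords]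
  let ?\<eta> = "i a unit_summand"
  define f where "f z s = (if z = unit_summand \<and> s = a then 1 / ?\<eta> else 0)" for z s
  have i_eq: "i z s = (if z = a \<and> s = unit_summand then ?\<eta> else 0)" for z s
  proof (cases "i z s = 0")
    case False
    then show ?thesis using mat_homD(1,2)[OF i False] by simp
  next
    case True
    then show ?thesis using \<eta> by auto
  qed
  have f: "f \<in> mat_hom {a} {unit_summand}" using a by (auto simp: mat_hom_def f_def)
  have uuu: "fuses S (unit_simple S) (unit_simple S) (unit_simple S)"
    using fuses_unit_left unit_mem by blast
  have aaa: "mult m a a a * ?\<eta> = 1" using algebra_unit_left[OF coords, of a a] by simp
  have m_eq: "m a s = (if s = Fuse a a (label a) then 1 / ?\<eta> else 0)" for s
  proof (cases "s = Fuse a a (label a)")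
    case True
    then show ?thesis using aaa \<eta> by (simp add: mult_def field_simps)
  next
    case False
    have "m a s = 0"
    proof (rule ccontr)
      assume "m a s \<noteq> 0"
      from mat_homD(2,3)[OF m this] False show False by (auto simp: sum_tensor_def)
    qed
    then show ?thesis using False by simp
  qed
  have "mat_comp f m z s = mat_comp (mat_lunit S {unit_summand}) (mat_tensor S f f) z s" for z s
  proof -
    let ?u = "Fuse unit_summand unit_summand (unit_simple S)"
    have "mat_comp f m z s = f z a * m a s"
      using mat_homD(1)[OF m] by (intro mat_comp_single) auto
    also have "\<dots> = (if z = unit_summand \<and> s = Fuse a a (unit_simple S) then 1 / ?\<eta> * (1 / ?\<eta>) else 0)"
      by (simp add: f_def m_eq a)
    also have "\<dots> = mat_lunit S {unit_summand} z ?u * mat_tensor S f f ?u s"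
    proof (cases s)
      case (Summand b n)
      then show ?thesis by (simp add: mat_tensor_def)
    next
      case (Fuse x y c)
      have "mat_tensor S f f ?u s = (if s = Fuse a a (unit_simple S) then 1 / ?\<eta> * (1 / ?\<eta>) else 0)"
        unfolding Fuse mat_tensor_Fuse f_def using uuu a unit_mem by auto
      then show ?thesis by (simp add: mat_lunit_def)
    qed
    also have "\<dots> = mat_comp (mat_lunit S {unit_summand}) (mat_tensor S f f) z s"
    proof (rule mat_comp_single[symmetric])
      fix r assume "mat_tensor S f f r s \<noteq> 0"
      then obtain x' y' x y c where r: "r = Fuse x' y' c" "c \<in> simples S" "fuses S (label x) (label y) c"
        "f x' x \<noteq> 0" "f y' y \<noteq> 0"
        by (rule mat_tensor_nonzeroE) blast
      from r(4,5) have "x' = unit_summand" "y' = unit_summand" "x = a" "y = a"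
        by (auto simp: f_def split: if_splits)
      with r(1-3) show "r = ?u" using a fuses_unit_left[OF unit_mem r(2)] by simp
    qed
    finally show ?thesis .
  qed
  moreover have "mat_comp f i = mat_diag (\<lambda>x. 1) {unit_summand}"
  proof (intro ext)
    fix z s
    have "mat_comp f i z s = f z a * i a s"
      using mat_homD(1)[OF i] by (intro mat_comp_single) auto
    then show "mat_comp f i z s = mat_diag (\<lambda>x. 1) {unit_summand} z s"
      using \<eta> i_eq[of a s] by (auto simp: f_def mat_diag_def)
  qed
  moreover have "mat_comp i f = mat_diag (\<lambda>x. 1) {a}"
  proof (intro ext)
    fix z s
    have "mat_comp i f z s = i z unit_summand * f unit_summand s"
      by (intro mat_comp_single) (auto simp: f_def split: if_splits)
    then show "mat_comp i f z s = mat_diag (\<lambda>x. 1) {a} z s"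
      using \<eta> i_eq[of z] by (auto simp: f_def mat_diag_def)
  qed
  ultimately show ?thesis
    unfolding isomorphic_algebras_def algebra_hom_def inverse_mor_def using f i
    by (intro exI[of _ f] exI[of _ i]) (auto simp: fun_eq_iff)
qed

end

section \<open>Fibonacci categories\<close>

text \<open>Removing the factor u + 1 from u^5 + 1 = 0 leaves the tenth cyclotomic polynomial;
  divided by u^2 it becomes the quadratic equation for a = u + 1/u. The value a = 0 would give u^4 =
  1, and a = 1 would give u^6 = 1.\<close>

lemma primitive_10_facts:
  fixes u :: "'k::field"
  assumes u: "primitive_root_of_unity 10 u"
  shows "u \<noteq> 0" "u ^ 2 \<noteq> 1" "u ^ 5 = -1"
    "(u + inverse u) * (u + inverse u) = (u + inverse u) + 1"
    "u + inverse u \<noteq> 0" "u + inverse u \<noteq> 1"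
proof -
  have u10: "u ^ 10 = 1" and min: "\<And>m. 0 < m \<Longrightarrow> m < 10 \<Longrightarrow> u ^ m \<noteq> 1"
    using u by (auto simp: primitive_root_of_unity_def)
  show nz: "u \<noteq> 0" using u10 by auto
  show u2: "u ^ 2 \<noteq> 1" using min by simp
  have "(u ^ 5 - 1) * (u ^ 5 + 1) = 0" using u10 by (simp add: algebra_simps flip: power_add)
  then show u5: "u ^ 5 = -1" using min[of 5] by (simp add: eq_neg_iff_add_eq_0)
  have "u + 1 \<noteq> 0" using u2 by (auto simp: power2_eq_square add_eq_0_iff2)
  moreover have "(u + 1) * (u ^ 4 - u ^ 3 + u ^ 2 - u + 1) = u ^ 5 + 1"
    by (simp add: algebra_simps numeral_eq_Suc)
  ultimately have *: "u ^ 4 - u ^ 3 + u ^ 2 - u + 1 = 0" using u5 by simp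
  have "u ^ 2 * ((u + inverse u) * (u + inverse u) - ((u + inverse u) + 1)) = u ^ 4 - u ^ 3 + u ^ 2 - u + 1"
    using nz by (simp add: field_simps numeral_eq_Suc)
  then show "(u + inverse u) * (u + inverse u) = (u + inverse u) + 1" using * nz by simp
  show "u + inverse u \<noteq> 0"
  proof
    assume "u + inverse u = 0"
    then have "u ^ 2 = -1" using nz by (simp add: field_simps power2_eq_square eq_neg_iff_add_eq_0)
    then have "(u ^ 2) ^ 2 = 1" by simp
    then show False using min[of 4] by (simp flip: power_mult)
  qed
  show "u + inverse u \<noteq> 1"
  proof
    assume "u + inverse u = 1"
    then have "u ^ 2 - u + 1 = 0" using nz by (simp add: field_simps power2_eq_square)
    moreover have "(u + 1) * (u ^ 2 - u + 1) = u ^ 3 + 1"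
      by (simp add: algebra_simps numeral_eq_Suc)
    ultimately have "u ^ 3 = -1" by (simp add: eq_neg_iff_add_eq_0)
    then have "(u ^ 3) ^ 2 = 1" by simp
    then show False using min[of 6] by (simp flip: power_mult)
  qed
qed

lemma UNIV_fib: "(UNIV :: fib set) = {I, X}"
  using fib.exhaust by auto

lemma sum_fib: "(\<Sum>e | P e. g e) = (if P I then g I else 0) + (if P X then g X else (0::'k::field))"
proof -
  have "(\<Sum>e | P e. g e) = (\<Sum>e\<in>{e \<in> {I, X}. P e}. g e)"
    by (rule sum.cong) (use UNIV_fib in auto)
  also have "\<dots> = (\<Sum>e\<in>{I, X}. if P e then g e else 0)" by (rule sum.inter_filter) simp
  finally show ?thesis by simp
qed

text \<open>With \<open>X\<close> in all four places the block has rows (-a, -a) and (1, a) in the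
  order \<open>I\<close>, \<open>X\<close>, and its square is the identity by a^2 = a + 1. Every
  other block has size at most one; exchanging its labels may leave the admissible range, where the
  catch-all value 1 of \<open>fib_assoc\<close> is the right one.\<close>

lemma fib_assoc_involutive:
  fixes u :: "'k::field"
  assumes a: "(u + inverse u) * (u + inverse u) = (u + inverse u) + 1"
  shows "\<lbrakk>fib_fuses b c f; fib_fuses a f d; fib_fuses b c f'; fib_fuses a f' d\<rbrakk> \<Longrightarrow>
      (\<Sum>e | fib_fuses a b e \<and> fib_fuses e c d. fib_assoc u a b c d f e * fib_assoc u a b c d e f') =
      (if f = f' then 1 else 0)" (is "PROP ?left")
    and "\<lbrakk>fib_fuses a b e; fib_fuses e c d; fib_fuses a b e'; fib_fuses e' c d\<rbrakk> \<Longrightarrow>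
      (\<Sum>f | fib_fuses b c f \<and> fib_fuses a f d. fib_assoc u a b c d e f * fib_assoc u a b c d f e') =
      (if e = e' then 1 else 0)" (is "PROP ?right")
proof -
  define t where "t = u + inverse u"
  have t: "t * t = t + 1" using a by (simp add: t_def)
  show "PROP ?left" unfolding sum_fib
    by (cases a; cases b; cases c; cases d; cases f; cases f'; simp add: t_def[symmetric] t)
  show "PROP ?right" unfolding sum_fib
    by (cases a; cases b; cases c; cases d; cases e; cases e'; simp add: t_def[symmetric] t)
qed

lemma fib_fuses_right_unit: "fib_fuses a I c \<longleftrightarrow> c = a"
  by (cases a; cases c) simp_all

lemma fib_fuses_commute: "fib_fuses a b c \<longleftrightarrow> fib_fuses b a c"
  by (cases a; cases b; cases c) simp_all

lemma fib_fuses_unit_iff: "fib_fuses a b I \<longleftrightarrow> b = a"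
  by (cases a; cases b) simp_all

lemma fib_assoc_unit_left: "fib_assoc u I b c d f e = 1"
  by (cases b; cases c; cases d; cases f; cases e) simp_all

lemma fib_braid_unit_right: "fib_braid u a I c = 1"
  by (cases a; cases c) simp_all

section \<open>Deligne products of Fibonacci categories\<close>

abbreviation "fib_product J u \<equiv> deligne_product J (\<lambda>i. fibonacci (u i))"

lemma fib_product_simps:
  "simples (fib_product J u) = PiE J (\<lambda>i. UNIV)"
  "unit_simple (fib_product J u) = (\<lambda>i\<in>J. I)"
  "fuses (fib_product J u) a b c \<longleftrightarrow> (\<forall>i\<in>J. fib_fuses (a i) (b i) (c i))"
  "assoc_coeff (fib_product J u) a b c d f e = (\<Prod>i\<in>J. fib_assoc (u i) (a i) (b i) (c i) (d i) (f i) (e i))"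
  "braid_coeff (fib_product J u) a b c = (\<Prod>i\<in>J. fib_braid (u i) (a i) (b i) (c i))"
  "twist_coeff (fib_product J u) a = (\<Prod>i\<in>J. fib_twist (u i) (a i))"
  by (simp_all add: deligne_product_def fibonacci_def)

lemma prod_delta_PiE:
  assumes "finite J" "f \<in> PiE J B" "g \<in> PiE J B"
  shows "(\<Prod>i\<in>J. if f i = g i then 1 else (0::'k::field)) = (if f = g then 1 else 0)"
proof (cases "f = g")
  case False
  then obtain i where "i \<in> J" "f i \<noteq> g i" using PiE_ext[OF assms(2,3)] by blast
  then have "(\<Prod>i\<in>J. if f i = g i then 1 else (0::'k)) = 0" using assms(1) by (intro prod_zero) auto
  then show ?thesis using False by simp
qed simp

lemma sum_PiE_fib:
  fixes g :: "'i \<Rightarrow> fib \<Rightarrow> 'k::field"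
  assumes "finite J"
  shows "(\<Sum>e | e \<in> PiE J (\<lambda>i. UNIV) \<and> (\<forall>i\<in>J. P i (e i)) \<and> (\<forall>i\<in>J. Q i (e i)). \<Prod>i\<in>J. g i (e i)) =
    (\<Prod>i\<in>J. \<Sum>e | P i e \<and> Q i e. g i e)"
proof -
  have "{e \<in> PiE J (\<lambda>i. UNIV). (\<forall>i\<in>J. P i (e i)) \<and> (\<forall>i\<in>J. Q i (e i))} = PiE J (\<lambda>i. {e. P i e \<and> Q i e})"
    by (auto simp: PiE_def Pi_def)
  moreover have "finite {e::fib. R e}" for R
    by (rule finite_subset[OF subset_UNIV]) (simp add: UNIV_fib)
  ultimately show ?thesis using prod_sum_PiE[OF assms, of "\<lambda>i. {e. P i e \<and> Q i e}" g] by simp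
qed

text \<open>Sums over families of labels factor into sums over single coordinates, and the resulting
  product of coordinate deltas is a delta of families because labels are extensional functions on
  \<open>J\<close>.\<close>

lemma involutive_fusion_fib_product:
  fixes u :: "'i \<Rightarrow> 'k::field"
  assumes J: "finite J" and u: "\<And>i. i \<in> J \<Longrightarrow> primitive_root_of_unity 10 (u i)"
  shows "involutive_fusion (fib_product J u)"
proof
  show "finite (simples (fib_product J u))"
    using J by (simp add: fib_product_simps finite_PiE UNIV_fib)
  show "unit_simple (fib_product J u) \<in> simples (fib_product J u)" by (simp add: fib_product_simps)
  fix a b c d f f' e e'
  show "assoc_coeff (fib_product J u) (unit_simple (fib_product J u)) b c d f e = 1"
    by (simp add: fib_product_simps fib_assoc_unit_left)
  show "braid_coeff (fib_product J u) a (unit_simple (fib_product J u)) c = 1"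
    by (simp add: fib_product_simps fib_braid_unit_right)
  show "fuses (fib_product J u) a b c \<longleftrightarrow> fuses (fib_product J u) b a c"
    using fib_fuses_commute by (auto simp: fib_product_simps)
  {
    assume "b \<in> simples (fib_product J u)" "c \<in> simples (fib_product J u)"
    then have "(\<forall>i\<in>J. c i = b i) \<longleftrightarrow> c = b" by (auto simp: fib_product_simps intro: PiE_ext)
    then show "fuses (fib_product J u) (unit_simple (fib_product J u)) b c \<longleftrightarrow> c = b"
      "fuses (fib_product J u) b (unit_simple (fib_product J u)) c \<longleftrightarrow> c = b"
      by (simp_all add: fib_product_simps fib_fuses_right_unit)
  }
  note inv = fib_assoc_involutive[OF primitive_10_facts(4)[OF u]]
  {
    assume f: "f \<in> simples (fib_product J u)" "f' \<in> simples (fib_product J u)"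
      and fus: "fuses (fib_product J u) b c f" "fuses (fib_product J u) a f d"
      "fuses (fib_product J u) b c f'" "fuses (fib_product J u) a f' d"
    have "(\<Sum>e | e \<in> simples (fib_product J u) \<and> fuses (fib_product J u) a b e \<and> fuses (fib_product J u) e c d.
         assoc_coeff (fib_product J u) a b c d f e * assoc_coeff (fib_product J u) a b c d e f') =
       (\<Prod>i\<in>J. \<Sum>e | fib_fuses (a i) (b i) e \<and> fib_fuses e (c i) (d i).
          fib_assoc (u i) (a i) (b i) (c i) (d i) (f i) e * fib_assoc (u i) (a i) (b i) (c i) (d i) e (f' i))"
      unfolding fib_product_simps prod.distrib[symmetric] by (rule sum_PiE_fib[OF J])
    also have "\<dots> = (\<Prod>i\<in>J. if f i = f' i then 1 else 0)"
      using fus by (intro prod.cong refl inv(1)) (auto simp: fib_product_simps)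
    also have "\<dots> = (if f = f' then 1 else 0)"
      using f J by (intro prod_delta_PiE) (auto simp: fib_product_simps)
    finally show "(\<Sum>e | e \<in> simples (fib_product J u) \<and> fuses (fib_product J u) a b e \<and> fuses (fib_product J u) e c d.
         assoc_coeff (fib_product J u) a b c d f e * assoc_coeff (fib_product J u) a b c d e f') =
       (if f = f' then 1 else 0)" .
  }
  {
    assume e: "e \<in> simples (fib_product J u)" "e' \<in> simples (fib_product J u)"
      and fus: "fuses (fib_product J u) a b e" "fuses (fib_product J u) e c d"
      "fuses (fib_product J u) a b e'" "fuses (fib_product J u) e' c d"
    have "(\<Sum>f | f \<in> simples (fib_product J u) \<and> fuses (fib_product J u) b c f \<and> fuses (fib_product J u) a f d.
         assoc_coeff (fib_product J u) a b c d e f * assoc_coeff (fib_product J u) a b c d f e') =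
       (\<Prod>i\<in>J. \<Sum>f | fib_fuses (b i) (c i) f \<and> fib_fuses (a i) f (d i).
          fib_assoc (u i) (a i) (b i) (c i) (d i) (e i) f * fib_assoc (u i) (a i) (b i) (c i) (d i) f (e' i))"
      unfolding fib_product_simps prod.distrib[symmetric] by (rule sum_PiE_fib[OF J])
    also have "\<dots> = (\<Prod>i\<in>J. if e i = e' i then 1 else 0)"
      using fus by (intro prod.cong refl inv(2)) (auto simp: fib_product_simps)
    also have "\<dots> = (if e = e' then 1 else 0)"
      using e J by (intro prod_delta_PiE) (auto simp: fib_product_simps)
    finally show "(\<Sum>f | f \<in> simples (fib_product J u) \<and> fuses (fib_product J u) b c f \<and> fuses (fib_product J u) a f d.
         assoc_coeff (fib_product J u) a b c d e f * assoc_coeff (fib_product J u) a b c d f e') =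
       (if e = e' then 1 else 0)" .
  }
qed

text \<open>Each coordinate \<open>X\<close> contributes u_i^(-2) to the twist. A single one would
  give u_i^2 = 1. Two would give (u_i u_j)^2 = 1, hence u_i u_j = -1, although its fifth power is
  (-1)(-1) = 1.\<close>

lemma fib_twist_support_ge_3:
  fixes u :: "'i \<Rightarrow> 'k::field"
  assumes J: "finite J" and u: "\<And>i. i \<in> J \<Longrightarrow> primitive_root_of_unity 10 (u i)"
    and no_inv: "\<And>i j. i \<in> J \<Longrightarrow> j \<in> J \<Longrightarrow> u i * u j \<noteq> 1"
    and twist: "twist_coeff (fib_product J u) s = 1" and ne: "{i \<in> J. s i = X} \<noteq> {}"
  shows "card {i \<in> J. s i = X} \<ge> 3"
proof (rule ccontr)
  let ?T = "{i \<in> J. s i = X}"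
  assume "\<not> card ?T \<ge> 3"
  moreover have "card ?T \<noteq> 0" using ne J by simp
  ultimately have "card ?T = 1 \<or> card ?T = 2" by linarith
  moreover have "(\<Prod>i\<in>J. fib_twist (u i) (s i)) = (\<Prod>i\<in>?T. inverse ((u i) ^ 2))"
  proof -
    have "fib_twist (u i) (s i) = (if s i = X then inverse ((u i) ^ 2) else 1)" for i
      by (cases "s i") simp_all
    then show ?thesis using J by (simp add: prod.inter_filter)
  qed
  then have prod1: "(\<Prod>i\<in>?T. inverse ((u i) ^ 2)) = 1" using twist by (simp add: fib_product_simps)
  ultimately show False
  proof (elim disjE)
    assume "card ?T = 1"
    then obtain i where T: "?T = {i}" by (auto simp: card_1_singleton_iff)
    then have "i \<in> J" by auto
    then show False using prod1 primitive_10_facts(2)[OF u] by (simp add: T)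
  next
    assume "card ?T = 2"
    then obtain i j where T: "?T = {i, j}" "i \<noteq> j" by (auto simp: card_2_iff)
    then have ij: "i \<in> J" "j \<in> J" by auto
    have "inverse ((u i * u j) ^ 2) = 1" using prod1 T by (simp add: power_mult_distrib)
    then have "(u i * u j) ^ 2 = 1" by (simp only: inverse_eq_1_iff)
    then have "u i * u j = 1 \<or> u i * u j = -1" by (simp only: power2_eq_1_iff)
    then have "u i * u j = -1" using no_inv[OF ij] by simp
    then have "(u i * u j) ^ 5 = -1" by simp
    \<comment> \<open>Over a general field 1 = -1 is no contradiction yet, but it turns the value -1
      of \<open>u i * u j\<close> into the forbidden value 1.\<close>
    then have one_eq: "(1::'k) = -1"
      using primitive_10_facts(3)[OF u[OF ij(1)]] primitive_10_facts(3)[OF u[OF ij(2)]]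
      by (simp add: power_mult_distrib)
    have "u i * u j = 1" using \<open>u i * u j = -1\<close> one_eq by simp
    then show False using no_inv[OF ij] by simp
  qed
qed

text \<open>Take a label \<open>s \<noteq> I\<close> of \<open>A\<close> whose set \<open>T\<close> of \<open>X\<close>-coordinates is as small as possible.  Then
  products of summands labelled \<open>s\<close> only have components labelled \<open>I\<close> or \<open>s\<close>, so the intermediate
  label \<open>e\<close> with \<open>X\<close>-coordinates \<open>E\<close>, for \<open>{} \<subset> E \<subset> T\<close>, contributes nothing to \<open>(xy)t\<close>.
  Comparing with \<open>x(yt)\<close>, this gives \<open>(\<Prod>i\<in>E. a i) * x(yt)\<^sub>s + (\<Prod>i\<in>T. - a i) * x(yt)\<^sub>I = 0\<close>,
  where \<open>a i = u i + inverse (u i)\<close> and the subscript is the label of the component of \<open>yt\<close>.  As \<open>T\<close> has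
  at least three elements, both \<open>E = {i}\<close> and \<open>E = {i, j}\<close> are allowed, whence \<open>x(yt)\<^sub>I = 0\<close>.\<close>

lemma fib_algebra_labels_unit:
  fixes u :: "'i \<Rightarrow> 'k::alg_closed_field"
  defines "S J \<equiv> fib_product J u"
  assumes J: "finite J" and u: "\<And>i. i \<in> J \<Longrightarrow> primitive_root_of_unity 10 (u i)"
    and no_inv: "\<And>i j. i \<in> J \<Longrightarrow> j \<in> J \<Longrightarrow> u i * u j \<noteq> 1"
    and alg: "is_algebra (semisimple_category (S J)) A m \<iota>"
    and simple: "simple_algebra (semisimple_category (S J)) A m \<iota>"
    and sep: "separable_algebra (semisimple_category (S J)) A m"
    and comm: "commutative_algebra (semisimple_category (S J)) A m"
    and ribbon: "ribbon_algebra (semisimple_category (S J)) A"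
    and xA: "x \<in> A"
  shows "label x = unit_simple (S J)"
proof (rule ccontr)
  assume "label x \<noteq> unit_simple (S J)"
  interpret involutive_fusion "S J"
    unfolding S_def using J u by (rule involutive_fusion_fib_product)
  have coords: "algebra_coords A m \<iota>" using alg is_algebra_iff by blast
  note mD = algebra_mult_nonzeroD[OF coords]
  define supp where "supp s = {i \<in> J. s i = X}" for s :: "'i \<Rightarrow> fib"
  have label_simple: "label y \<in> PiE J (\<lambda>i. UNIV)" if "y \<in> A" for y
    using algebra_label[OF coords that] by (simp add: S_def fib_product_simps)
  have supp_inj: "s = s'" if "s \<in> PiE J (\<lambda>i. UNIV)" "s' \<in> PiE J (\<lambda>i. UNIV)" "supp s = supp s'" for s s'
  proof (rule PiE_ext[OF that(1,2)])
    fix i assume "i \<in> J"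
    then have "s i = X \<longleftrightarrow> s' i = X" using that(3) unfolding supp_def by blast
    then show "s i = s' i" by (cases "s i"; cases "s' i") simp_all
  qed
  have unit_simple: "unit_simple (S J) \<in> PiE J (\<lambda>i. UNIV)" "supp (unit_simple (S J)) = {}"
    by (auto simp: S_def fib_product_simps supp_def)
  have fin_supp: "finite (supp s)" for s using J by (simp add: supp_def)
  define Q where "Q y \<longleftrightarrow> y \<in> A \<and> label y \<noteq> unit_simple (S J)" for y
  define y0 where "y0 = arg_min (\<lambda>y. card (supp (label y))) Q"
  have "Q x" using xA \<open>label x \<noteq> _\<close> by (simp add: Q_def)
  then have Q0: "Q y0" and min: "\<And>y. Q y \<Longrightarrow> card (supp (label y0)) \<le> card (supp (label y))"
    unfolding y0_def by (auto intro: arg_min_natI arg_min_nat_le)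
  define s where "s = label y0"
  have s: "s \<in> PiE J (\<lambda>i. UNIV)" "supp s \<noteq> {}"
    using Q0 label_simple supp_inj[OF _ unit_simple(1)] unit_simple(2) by (auto simp: Q_def s_def)
  have y0: "y0 \<in> A" "label y0 = s" using Q0 by (auto simp: Q_def s_def)
  have minimal: "label y = unit_simple (S J) \<or> label y = s" if y: "y \<in> A" "supp (label y) \<subseteq> supp s" for y
  proof (cases "Q y")
    case True
    then have "supp (label y) = supp s"
      using min[OF True] y(2) fin_supp card_seteq by (metis s_def)
    then show ?thesis using supp_inj[OF label_simple[OF y(1)] s(1)] by blast
  next
    case False
    then show ?thesis using y by (simp add: Q_def)
  qed
  have "twist_coeff (S J) s = 1"
    using fun_cong[OF fun_cong[OF ribbon[unfolded ribbon_algebra_def C_simps]], of y0 y0] y0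
    by (simp add: mat_diag_def)
  then have card_s: "card (supp s) \<ge> 3"
    using fib_twist_support_ge_3[OF J u no_inv, where s = s] s(2) by (simp add: S_def supp_def)
  then obtain i j where ij: "i \<in> supp s" "j \<in> supp s" "i \<noteq> j" and ij_ne: "supp s \<noteq> {i, j}"
  proof -
    have "2 \<le> card (supp s)" using card_s by simp
    then obtain B where "B \<subseteq> supp s" "card B = 2" by (rule obtain_subset_with_card_n)
    then obtain i j where "B = {i, j}" "i \<noteq> j" by (auto simp: card_2_iff)
    moreover have "supp s \<noteq> B" using \<open>card B = 2\<close> card_s by auto
    ultimately show ?thesis using that[of i j] \<open>B \<subseteq> supp s\<close> by auto
  qed
  define av where "av i = u i + inverse (u i)" for i
  define c where "c = (\<Prod>i\<in>supp s. - av i)"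
  have av: "av i \<noteq> 0" "av i \<noteq> 1" if "i \<in> J" for i
    using primitive_10_facts(5,6)[OF u[OF that]] by (simp_all add: av_def)
  have c0: "c \<noteq> 0" unfolding c_def using av fin_supp by (auto simp: supp_def)

  obtain a where a: "a \<in> A" "label a = unit_simple (S J)" "\<iota> a unit_summand \<noteq> 0"
    and a_unique: "\<And>y. \<lbrakk>y \<in> A; label y = unit_simple (S J)\<rbrakk> \<Longrightarrow> y = a"
    by (rule simple_algebra_connected[OF involutive_fusion_axioms alg comm simple]) blast
  \<comment> \<open>The partner \<open>t\<close> of \<open>y0\<close> pairs into the unique unit
    summand \<open>a\<close>. Its label is again \<open>s\<close>, every simple object being its own
    dual.\<close>
  obtain t w where t: "w \<in> A" "t \<in> A" "label w = unit_simple (S J)" "mult m w y0 t \<noteq> 0"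
    by (rule separable_pairing[OF alg sep y0(1)])
  then have wa: "mult m a y0 t \<noteq> 0" using a_unique by blast
  have lt: "label t = s"
  proof (rule PiE_ext[OF label_simple[OF t(2)] s(1)])
    fix i assume "i \<in> J"
    then show "label t i = s i"
      using mD(5)[OF wa] a(2) y0(2) by (simp add: S_def fib_product_simps fib_fuses_unit_iff)
  qed
  \<comment> \<open>\<open>P\<close> and \<open>R\<close> are the two contributions to the
    coefficient of \<open>y0\<close> in y0 (y0 t), through the components of y0 t labelled
    \<open>s\<close> and by the unit; the associator weights are left out.\<close>
  define P where "P = (\<Sum>f | f \<in> A \<and> label f = s. mult m y0 y0 f * mult m f y0 t)"
  define R where "R = mult m y0 y0 a * mult m a y0 t"
  have relation: "(\<Prod>i\<in>E. av i) * P + c * R = 0" if E: "E \<subseteq> supp s" "E \<noteq> {}" "E \<noteq> supp s" for E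
  proof -
    define e where "e = (\<lambda>i\<in>J. if i \<in> E then X else I)"
    have e: "e \<in> simples (S J)" "supp e = E"
      using E by (auto simp: S_def fib_product_simps e_def supp_def)
    have no_e: "{e' \<in> A. label e' = e} = {}"
    proof (rule ccontr)
      assume "\<not> ?thesis"
      then obtain e' where e': "e' \<in> A" "label e' = e" by auto
      then show False using minimal[of e'] e(2) E unit_simple(2) by auto
    qed
    \<comment> \<open>Admissible because X tensor X contains both \<open>I\<close> and
      \<open>X\<close>: outside \<open>E\<close> the label \<open>e\<close> takes the value
      \<open>I\<close>, inside it the value \<open>X\<close>.\<close>
    have fus: "fuses (S J) s s e" "fuses (S J) e s s"
    proof -
      have "fib_fuses (s i) (s i) (e i) \<and> fib_fuses (e i) (s i) (s i)" if "i \<in> J" for i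
        using that E(1) by (cases "s i") (auto simp: e_def supp_def)
      then show "fuses (S J) s s e" "fuses (S J) e s s" by (auto simp: S_def fib_product_simps)
    qed
    have F_s: "assoc_coeff (S J) s s s s s e = (\<Prod>i\<in>E. av i)"
    proof -
      have "fib_assoc (u i) (s i) (s i) (s i) (s i) (s i) (e i) = (if i \<in> E then av i else 1)" if "i \<in> J" for i
        using that E(1) by (cases "s i") (auto simp: e_def supp_def av_def)
      then have "assoc_coeff (S J) s s s s s e = (\<Prod>i\<in>J. if i \<in> E then av i else 1)"
        by (simp add: S_def fib_product_simps)
      also have "\<dots> = (\<Prod>i\<in>{i \<in> J. i \<in> E}. av i)" using J by (rule prod.inter_filter[symmetric])
      also have "{i \<in> J. i \<in> E} = E" using E(1) by (auto simp: supp_def)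
      finally show ?thesis .
    qed
    \<comment> \<open>The weight of the unit component is -a for either value of \<open>e\<close> at
      a coordinate \<open>X\<close>. Hence \<open>c\<close> is the same for all \<open>E\<close>,
      unlike the weight in \<open>F_s\<close>, and can be eliminated between two choices of
      \<open>E\<close>.\<close>
    have F_I: "assoc_coeff (S J) s s s s (unit_simple (S J)) e = c"
    proof -
      have "fib_assoc (u i) (s i) (s i) (s i) (s i) I (e i) = (if s i = X then - av i else 1)" for i
        by (cases "s i") (auto simp: av_def fib_assoc_unit_left)
      then have "assoc_coeff (S J) s s s s (unit_simple (S J)) e = (\<Prod>i\<in>J. if s i = X then - av i else 1)"
        by (simp add: S_def fib_product_simps)
      then show ?thesis using J by (simp add: c_def supp_def prod.inter_filter)
    qed
    let ?g = "\<lambda>f. assoc_coeff (S J) s s s s (label f) e * (mult m y0 y0 f * mult m f y0 t)"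
    have "(\<Sum>f\<in>A. ?g f) = 0"
      using algebra_assoc[OF coords y0(1) y0(1) t(2) y0(1) e(1)] fus no_e by (simp add: y0(2) lt)
    \<comment> \<open>Where \<open>s\<close> is \<open>I\<close>, so is every label occurring in y0
      t. Its support therefore lies in that of \<open>s\<close>, and minimality leaves only
      \<open>s\<close> and the unit.\<close>
    moreover have "(\<Sum>f\<in>A. ?g f) = (\<Sum>f\<in>{f \<in> A. label f = s} \<union> {a}. ?g f)"
    proof (rule sum.mono_neutral_right)
      show "\<forall>f\<in>A - ({f \<in> A. label f = s} \<union> {a}). ?g f = 0"
      proof
        fix f assume f: "f \<in> A - ({f \<in> A. label f = s} \<union> {a})"
        have "mult m f y0 t = 0"
        proof (rule ccontr)
          assume "mult m f y0 t \<noteq> 0"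
          from mD(5)[OF this] have fu: "\<forall>i\<in>J. fib_fuses (s i) (s i) (label f i)"
            by (simp add: y0(2) lt S_def fib_product_simps)
          have "supp (label f) \<subseteq> supp s"
          proof
            fix i assume "i \<in> supp (label f)"
            then show "i \<in> supp s" using bspec[OF fu, of i] by (cases "s i") (auto simp: supp_def)
          qed
          then show False using minimal[of f] f a_unique by auto
        qed
        then show "?g f = 0" by simp
      qed
    qed (use algebra_A[OF coords] a in auto)
    also have "\<dots> = (\<Sum>f | f \<in> A \<and> label f = s. ?g f) + ?g a"
    proof -
      have "s \<noteq> unit_simple (S J)" using s(2) unit_simple(2) by auto
      then show ?thesis using algebra_A[OF coords] a by (subst sum.union_disjoint) auto
    qed
    also have "(\<Sum>f | f \<in> A \<and> label f = s. ?g f) = (\<Prod>i\<in>E. av i) * P"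
      unfolding P_def sum_distrib_left by (rule sum.cong) (simp_all add: F_s)
    also have "?g a = c * R" by (simp add: a(2) F_I R_def)
    finally show ?thesis by simp
  qed
  have "supp s \<noteq> {i}" using ij by auto
  then have rel_i: "av i * P + c * R = 0" using relation[of "{i}"] ij by auto
  have "av i * av j * P + c * R = 0" using relation[of "{i, j}"] ij ij_ne by auto
  \<comment> \<open>The common term \<open>c * R\<close> cancels, leaving \<open>P\<close> times a_i
    (a_j - 1). This is non-zero unless \<open>P\<close> is, as a is neither 0 nor 1.\<close>
  then have "av i * av j * P + c * R = av i * P + c * R" using rel_i by simp
  then have "av i * (av j - 1) * P = 0" by (simp add: algebra_simps)
  then have "P = 0" using av[of i] av[of j] ij by (auto simp: supp_def)
  then have "R = 0" using rel_i c0 by simp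
  then have "mult m y0 y0 a = 0" using wa by (simp add: R_def)
  \<comment> \<open>Only \<open>a\<close> carries the unit, so the right unit law at
    \<open>y0\<close> makes the coefficient of \<open>y0\<close> in y0 a non-zero, against the
    vanishing just derived.\<close>
  moreover have "(\<Sum>b\<in>A. mult m y0 y0 b * \<iota> b unit_summand) = mult m y0 y0 a * \<iota> a unit_summand"
  proof -
    have "\<iota> b unit_summand = 0" if "b \<in> A" "b \<noteq> a" for b
      using mat_homD(3)[OF algebra_unit[OF coords], of b unit_summand] a_unique[of b] that by auto
    then have "(\<Sum>b\<in>A. mult m y0 y0 b * \<iota> b unit_summand) = (\<Sum>b\<in>{a}. mult m y0 y0 b * \<iota> b unit_summand)"
      using algebra_A[OF coords] a by (intro sum.mono_neutral_right) auto
    then show ?thesis by simp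
  qed
  ultimately show False using algebra_unit_right[OF coords y0(1) y0(1)] by simp
qed

theorem mainTheorem2:
  fixes u :: "nat \<Rightarrow> 'k::{alg_closed_field, field_char_0}" and l :: nat
  assumes "l \<ge> 1"
    and "\<And>i. i \<in> {1..l} \<Longrightarrow> primitive_root_of_unity 10 (u i)"
    and "\<And>i j. i \<in> {1..l} \<Longrightarrow> j \<in> {1..l} \<Longrightarrow> u i * u j \<noteq> 1"
  shows "completely_anisotropic
           (semisimple_category (deligne_product {1..l} (\<lambda>i. fibonacci (u i))))"
  unfolding completely_anisotropic_def
proof (intro allI impI, elim conjE)
  let ?S = "fib_product {1..l} u"
  interpret involutive_fusion ?S
    using assms(2) by (intro involutive_fusion_fib_product) auto
  fix A m i
  assume alg: "is_algebra C A m i" and simple: "simple_algebra C A m i" and sep: "separable_algebra C A m"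
    and comm: "commutative_algebra C A m" and ribbon: "ribbon_algebra C A"
  have unit: "label x = unit_simple ?S" if "x \<in> A" for x
    using fib_algebra_labels_unit[of "{1..l}" u A m i x] assms(2,3) alg simple sep comm ribbon that by simp
  obtain a where a: "a \<in> A" "label a = unit_simple ?S" "i a unit_summand \<noteq> 0"
    and a_unique: "\<And>y. \<lbrakk>y \<in> A; label y = unit_simple ?S\<rbrakk> \<Longrightarrow> y = a"
    by (rule simple_algebra_connected[OF involutive_fusion_axioms alg comm simple]) blast
  have "A = {a}" using a a_unique unit by blast
  then show "isomorphic_algebras C A m i (Unit C) (LUnit C (Unit C)) (Id C (Unit C))"
    using singleton_algebra_isomorphic_unit[of a m i] alg a by simp
qed

end
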